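(* Let $G=(V,E,\infty)$ be a temporal graph with unrestricted waiting, with $M=|E|$, given in doubly-sorted representation (the list of its temporal edges sorted by non-decreasing arrival time and the list sorted by non-decreasing departure time). There is an algorithm that, for any source $s\in V$, correctly computes the $s$-Sh betweenness $b_{s,e}$ of every temporal edge $e\in E$ using $O(M)$ operations.
   Context: A temporal graph is a triple $G=(V,E,\beta)$ with $\beta\in\mathbb{N}\cup\{+\infty\}$ the maximum waiting time; here $\beta=+\infty$. A temporal edge is a quadruple $e=(u,v,\tau,\lambda)$ with tail $u$, head $v$, departure time $\tau\in\mathbb{N}$ and travel time $\lambda\in\mathbb{N}^{+}$; its arrival time is $\mathrm{arr}(e)=\tau+\lambda$. A walk from $s$ to $t$ ($st$-walk) is a sequence $e_1,\dots,e_k$ of temporal edges $e_i=(u_i,v_i,\tau_i,\lambda_i)$ with $u_1=s$, $v_k=t$, and for each $i<k$: $u_{i+1}=v_i$ and $\mathrm{arr}(e_i)\le\tau_{i+1}\le\mathrm{arr}(e_i)+\beta$. Its length is $k$. An $st$-walk is shortest (Sh) if no $st$-walk has fewer temporal edges. For $s\ne t$ and $e\in E$, $\sigma_{s,e,t}$ denotes the number of Sh $st$-walks containing $e$, and $\sigma_{s,t}$ the number of Sh $st$-walks. Let $\chi_{s,t}=1$ if $s\neq t$ and an $st$-walk exists, $0$ otherwise. The $s$-Sh betweenness of $e$ is $b_{s,e}=\sum_{t\in V:\chi_{s,t}=1}\sigma_{s,e,t}/\sigma_{s,t}$. *)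

theory Defs
  imports Complex_Main "HOL-Library.Extended_Nat" "HOL-Library.Landau_Symbols"
begin

section \<open>Temporal graphs, shortest walks and betweenness\<close>

datatype 'v tedge = TEdge (tail: 'v) (head: 'v) (dep: nat) (trav: nat)

definition arr :: "'v tedge \<Rightarrow> nat" where
  "arr e = dep e + trav e"

record 'v temporal_graph =
  verts :: "'v set"
  edges :: "'v tedge set"
  max_wait :: enat

definition wf_temporal_graph :: "'v temporal_graph \<Rightarrow> bool" where
  "wf_temporal_graph G \<longleftrightarrow> finite (verts G) \<and> finite (edges G) \<and>
     (\<forall>e \<in> edges G. tail e \<in> verts G \<and> head e \<in> verts G \<and> trav e > 0)"

definition walk :: "'v temporal_graph \<Rightarrow> 'v \<Rightarrow> 'v \<Rightarrow> 'v tedge list \<Rightarrow> bool" where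
  "walk G s t w \<longleftrightarrow> w \<noteq> [] \<and> set w \<subseteq> edges G \<and> tail (hd w) = s \<and> head (last w) = t \<and>
     (\<forall>i. Suc i < length w \<longrightarrow>
        tail (w ! Suc i) = head (w ! i) \<and>
        arr (w ! i) \<le> dep (w ! Suc i) \<and>
        enat (dep (w ! Suc i)) \<le> enat (arr (w ! i)) + max_wait G)"

definition shortest_walk :: "'v temporal_graph \<Rightarrow> 'v \<Rightarrow> 'v \<Rightarrow> 'v tedge list \<Rightarrow> bool" where
  "shortest_walk G s t w \<longleftrightarrow> walk G s t w \<and> (\<forall>w'. walk G s t w' \<longrightarrow> length w \<le> length w')"

definition sigma :: "'v temporal_graph \<Rightarrow> 'v \<Rightarrow> 'v \<Rightarrow> nat" where
  "sigma G s t = card {w. shortest_walk G s t w}"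

definition sigma_edge :: "'v temporal_graph \<Rightarrow> 'v \<Rightarrow> 'v tedge \<Rightarrow> 'v \<Rightarrow> nat" where
  "sigma_edge G s e t = card {w. shortest_walk G s t w \<and> e \<in> set w}"

definition chi :: "'v temporal_graph \<Rightarrow> 'v \<Rightarrow> 'v \<Rightarrow> nat" where
  "chi G s t = (if s \<noteq> t \<and> (\<exists>w. walk G s t w) then 1 else 0)"

definition betweenness :: "'v temporal_graph \<Rightarrow> 'v \<Rightarrow> 'v tedge \<Rightarrow> rat" where
  "betweenness G s e =
     (\<Sum>t \<in> {t \<in> verts G. chi G s t = 1}. of_nat (sigma_edge G s e t) / of_nat (sigma G s t))"

definition doubly_sorted ::
    "'v temporal_graph \<Rightarrow> 'v tedge list \<Rightarrow> 'v tedge list \<Rightarrow> bool" where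
  "doubly_sorted G Earr Edep \<longleftrightarrow>
     distinct Earr \<and> set Earr = edges G \<and> sorted (map arr Earr) \<and>
     distinct Edep \<and> set Edep = edges G \<and> sorted (map dep Edep)"

section \<open>Unit-cost random access machine\<close>

text \<open>
  Algorithms are finite imperative programs over a random access memory. The memory has
  natural-number cells, used for identifiers, times, lengths and as addresses, and rational cells,
  used for walk counts and betweenness values. A cell is addressed by the name of an array and
  an index that may itself be computed (indirect addressing); a scalar variable is cell 0 of its
  array. There is no conversion (such as rounding) from rational to natural-number cells, so
  the result of a rational operation is never used as an address.
\<close>

type_synonym vname = string

record state =
  nmem :: "vname \<Rightarrow> nat \<Rightarrow> nat"
  qmem :: "vname \<Rightarrow> nat \<Rightarrow> rat"

datatype nexp =
    NConst nat
  | NGet vname nexp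
  | NAdd nexp nexp
  | NSub nexp nexp

datatype qexp =
    QConst rat
  | QNat nexp
  | QGet vname nexp
  | QAdd qexp qexp
  | QSub qexp qexp
  | QMul qexp qexp
  | QDiv qexp qexp

datatype bexp =
    NLess nexp nexp
  | NEq nexp nexp
  | QLess qexp qexp
  | BNot bexp
  | BAnd bexp bexp

datatype com =
    Skip
  | NSet vname nexp nexp
  | QSet vname nexp qexp
  | Seq com com
  | If bexp com com
  | While bexp com

fun nval :: "nexp \<Rightarrow> state \<Rightarrow> nat" where
  "nval (NConst n) S = n"
| "nval (NGet x a) S = nmem S x (nval a S)"
| "nval (NAdd a b) S = nval a S + nval b S"
| "nval (NSub a b) S = nval a S - nval b S"

fun qval :: "qexp \<Rightarrow> state \<Rightarrow> rat" where
  "qval (QConst r) S = r"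
| "qval (QNat a) S = of_nat (nval a S)"
| "qval (QGet x a) S = qmem S x (nval a S)"
| "qval (QAdd p q) S = qval p S + qval q S"
| "qval (QSub p q) S = qval p S - qval q S"
| "qval (QMul p q) S = qval p S * qval q S"
| "qval (QDiv p q) S = qval p S / qval q S"

fun bval :: "bexp \<Rightarrow> state \<Rightarrow> bool" where
  "bval (NLess a b) S \<longleftrightarrow> nval a S < nval b S"
| "bval (NEq a b) S \<longleftrightarrow> nval a S = nval b S"
| "bval (QLess p q) S \<longleftrightarrow> qval p S < qval q S"
| "bval (BNot c) S \<longleftrightarrow> \<not> bval c S"
| "bval (BAnd c d) S \<longleftrightarrow> bval c S \<and> bval d S"

text \<open>
  Every constant, memory access, arithmetic operation, comparison, Boolean connective,
  assignment, skip and branch (including each test of a loop) counts as one operation.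
\<close>

fun ncost :: "nexp \<Rightarrow> nat" where
  "ncost (NConst n) = 1"
| "ncost (NGet x a) = 1 + ncost a"
| "ncost (NAdd a b) = 1 + ncost a + ncost b"
| "ncost (NSub a b) = 1 + ncost a + ncost b"

fun qcost :: "qexp \<Rightarrow> nat" where
  "qcost (QConst r) = 1"
| "qcost (QNat a) = 1 + ncost a"
| "qcost (QGet x a) = 1 + ncost a"
| "qcost (QAdd p q) = 1 + qcost p + qcost q"
| "qcost (QSub p q) = 1 + qcost p + qcost q"
| "qcost (QMul p q) = 1 + qcost p + qcost q"
| "qcost (QDiv p q) = 1 + qcost p + qcost q"

fun bcost :: "bexp \<Rightarrow> nat" where
  "bcost (NLess a b) = 1 + ncost a + ncost b"
| "bcost (NEq a b) = 1 + ncost a + ncost b"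
| "bcost (QLess p q) = 1 + qcost p + qcost q"
| "bcost (BNot c) = 1 + bcost c"
| "bcost (BAnd c d) = 1 + bcost c + bcost d"

definition nwrite :: "vname \<Rightarrow> nat \<Rightarrow> nat \<Rightarrow> state \<Rightarrow> state" where
  "nwrite x i n S = S\<lparr>nmem := (nmem S)(x := (nmem S x)(i := n))\<rparr>"

definition qwrite :: "vname \<Rightarrow> nat \<Rightarrow> rat \<Rightarrow> state \<Rightarrow> state" where
  "qwrite x i r S = S\<lparr>qmem := (qmem S)(x := (qmem S x)(i := r))\<rparr>"

text \<open>
  \<open>exec c S k S'\<close>: started in \<open>S\<close>, the program \<open>c\<close> terminates in \<open>S'\<close> after exactly
  \<open>k\<close> operations.
\<close>

inductive exec :: "com \<Rightarrow> state \<Rightarrow> nat \<Rightarrow> state \<Rightarrow> bool" where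
  Skip: "exec Skip S 1 S"
| NSet: "exec (NSet x a b) S (1 + ncost a + ncost b) (nwrite x (nval a S) (nval b S) S)"
| QSet: "exec (QSet x a q) S (1 + ncost a + qcost q) (qwrite x (nval a S) (qval q S) S)"
| Seq: "exec c S k S' \<Longrightarrow> exec d S' l S'' \<Longrightarrow> exec (Seq c d) S (k + l) S''"
| IfTrue: "bval b S \<Longrightarrow> exec c S k S' \<Longrightarrow> exec (If b c d) S (1 + bcost b + k) S'"
| IfFalse: "\<not> bval b S \<Longrightarrow> exec d S k S' \<Longrightarrow> exec (If b c d) S (1 + bcost b + k) S'"
| WhileFalse: "\<not> bval b S \<Longrightarrow> exec (While b c) S (1 + bcost b) S"
| WhileTrue: "bval b S \<Longrightarrow> exec c S k S' \<Longrightarrow> exec (While b c) S' l S'' \<Longrightarrow>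
    exec (While b c) S (1 + bcost b + k + l) S''"

inductive_cases exec_SkipE: "exec Skip S k S'"
inductive_cases exec_NSetE: "exec (NSet x a b) S k S'"
inductive_cases exec_QSetE: "exec (QSet x a q) S k S'"
inductive_cases exec_SeqE: "exec (Seq c d) S k S'"
inductive_cases exec_IfE: "exec (If b c d) S k S'"
inductive_cases exec_WhileE: "exec (While b c) S k S'"

lemma exec_deterministic:
  "exec c S k S' \<Longrightarrow> exec c S l S'' \<Longrightarrow> l = k \<and> S'' = S'"
proof (induction arbitrary: l S'' rule: exec.induct)
  case Skip
  from Skip show ?case
    by (rule exec_SkipE) simp
next
  case NSet
  from NSet show ?case
    by (rule exec_NSetE) simp
next
  case QSet
  from QSet show ?case
    by (rule exec_QSetE) simp
next
  case Seq
  from Seq.prems show ?case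
    by (rule exec_SeqE) (auto dest: Seq.IH)
next
  case IfTrue
  from IfTrue.prems show ?case
    by (rule exec_IfE) (auto simp: IfTrue.hyps(1) dest: IfTrue.IH)
next
  case IfFalse
  from IfFalse.prems show ?case
    by (rule exec_IfE) (auto simp: IfFalse.hyps(1) dest: IfFalse.IH)
next
  case WhileFalse
  from WhileFalse.prems show ?case
    by (rule exec_WhileE) (simp_all add: WhileFalse.hyps)
next
  case WhileTrue
  from WhileTrue.prems show ?case
    by (rule exec_WhileE) (auto simp: WhileTrue.hyps(1) dest: WhileTrue.IH)
qed

section \<open>Input encoding\<close>

text \<open>
  Vertices are numbers. The temporal edges are objects numbered by their position in \<open>es\<close>, with
  their four components stored in four arrays. The two sorted lists are stored as arrays of
  references to these objects, so that the two occurrences of an edge can be related to each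
  other. All other cells of \<open>S\<close> are unconstrained: an algorithm may not rely on the memory
  being initialised outside its input.
\<close>

definition encodes_input ::
    "state \<Rightarrow> nat tedge list \<Rightarrow> nat tedge list \<Rightarrow> nat tedge list \<Rightarrow> nat \<Rightarrow> bool" where
  "encodes_input S es Earr Edep s \<longleftrightarrow>
     distinct es \<and> set es = set Earr \<and>
     nmem S ''source'' 0 = s \<and>
     nmem S ''M'' 0 = length es \<and>
     (\<forall>i < length es.
        nmem S ''tail'' i = tail (es ! i) \<and>
        nmem S ''head'' i = head (es ! i) \<and>
        nmem S ''dep'' i = dep (es ! i) \<and>
        nmem S ''trav'' i = trav (es ! i)) \<and>
     (\<forall>i < length Earr. nmem S ''Earr'' i < length es \<and> es ! nmem S ''Earr'' i = Earr ! i) \<and>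
     (\<forall>i < length Edep. nmem S ''Edep'' i < length es \<and> es ! nmem S ''Edep'' i = Edep ! i)"

end

theory Submission
  imports Defs
begin

text \<open>
  Write \<open>len e\<close> and \<open>num e\<close> for the length and the number of the shortest walks from \<open>s\<close> that end with
  the temporal edge \<open>e\<close>. With unrestricted waiting, such a walk is extended optimally by \<open>f\<close> iff \<open>f\<close>
  leaves the head of \<open>e\<close> no earlier than \<open>arr e\<close> and \<open>len f = len e + 1\<close>. Hence \<open>b\<^sub>s\<^sub>,\<^sub>e\<close> is \<open>num e\<close> times
  the dependency of \<open>e\<close>, where the dependency is \<open>1 / \<sigma>\<^sub>s\<^sub>,\<^sub>t\<close> if \<open>e\<close> ends a shortest walk to its head
  \<open>t \<noteq> s\<close>, plus the sum of the dependencies of these edges \<open>f\<close>.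

  Merging the two sorted lists gives one chronological sequence of arrivals and departures. Sweeping
  it forwards, it suffices to keep at each vertex the least \<open>len\<close> among the edges that have arrived
  there and the sum of \<open>num\<close> over the edges attaining it: when \<open>f\<close> departs, these are exactly its
  optimal predecessors. Sweeping it backwards, it suffices to keep at each vertex the greatest \<open>len\<close>
  among the edges that depart later and the sum of the dependencies over the edges attaining it:
  no edge \<open>f\<close> that can follow \<open>e\<close> has \<open>len f > len e + 1\<close>.
\<close>

section \<open>Counting shortest walks by their last edge\<close>

definition follows :: "'v tedge \<Rightarrow> 'v tedge \<Rightarrow> bool" where
  "follows f e \<longleftrightarrow> head f = tail e \<and> arr f \<le> dep e"

locale unrestricted_temporal_graph =
  fixes G :: "'v temporal_graph" and s :: 'v
  assumes wf: "wf_temporal_graph G" and unrestricted: "max_wait G = \<infinity>"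
begin

text \<open>Walks are grouped by last edge, not by last vertex, because which edges may be appended
  depends on the last edge alone. Groups for different last edges are disjoint, so their counts add
  up.\<close>

definition walks_to :: "'v tedge \<Rightarrow> nat \<Rightarrow> 'v tedge list set" where
  "walks_to e n = {w. w \<noteq> [] \<and> set w \<subseteq> edges G \<and> tail (hd w) = s \<and> successively follows w \<and>
     last w = e \<and> length w = n}"

definition reachable :: "'v tedge \<Rightarrow> bool" where
  "reachable e \<longleftrightarrow> (\<exists>n. walks_to e n \<noteq> {})"

text \<open>The value of \<open>len\<close> at an unreachable edge is unspecified, but \<open>num\<close> is \<open>0\<close> there.\<close>

definition len :: "'v tedge \<Rightarrow> nat" where
  "len e = (LEAST n. walks_to e n \<noteq> {})"

definition num :: "'v tedge \<Rightarrow> nat" where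
  "num e = card (walks_to e (len e))"

definition arrivals :: "'v \<Rightarrow> 'v tedge set" where
  "arrivals t = {e \<in> edges G. reachable e \<and> head e = t}"

text \<open>Unspecified when \<open>arrivals t\<close> is empty. At the source it measures closed
  walks and is not 0.\<close>

definition distance :: "'v \<Rightarrow> nat" where
  "distance t = Min (len ` arrivals t)"

definition extensions :: "'v tedge \<Rightarrow> 'v \<Rightarrow> nat \<Rightarrow> 'v tedge list set" where
  "extensions e t n = {x. set x \<subseteq> edges G \<and> successively follows (e # x) \<and>
     head (last (e # x)) = t \<and> length x = n}"

text \<open>The guard counters truncated subtraction: if \<open>len e\<close> exceeds
  \<open>distance t\<close> and \<open>head e = t\<close>, the empty extension would be counted
  although \<open>e\<close> lies on no shortest walk to \<open>t\<close>.\<close>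

definition ext_num :: "'v tedge \<Rightarrow> 'v \<Rightarrow> nat" where
  "ext_num e t = (if len e \<le> distance t then card (extensions e t (distance t - len e)) else 0)"

definition dependency :: "'v tedge \<Rightarrow> rat" where
  "dependency e =
     (\<Sum>t \<in> {t \<in> verts G. chi G s t = 1}. of_nat (ext_num e t) / of_nat (sigma G s t))"

lemma finite_edges: "finite (edges G)"
  using wf by (simp add: wf_temporal_graph_def)

lemma finite_verts: "finite (verts G)"
  using wf by (simp add: wf_temporal_graph_def)

lemma finite_walks_to: "finite (walks_to e n)"
  by (rule finite_subset[OF _ finite_lists_length_eq[OF finite_edges, of n]])
    (auto simp: walks_to_def)

lemma finite_extensions: "finite (extensions e t n)"
  by (rule finite_subset[OF _ finite_lists_length_eq[OF finite_edges, of n]])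
    (auto simp: extensions_def)

lemma finite_arrivals: "finite (arrivals t)"
  by (simp add: arrivals_def finite_edges)

lemma walks_to_len: "reachable e \<Longrightarrow> walks_to e (len e) \<noteq> {}"
  unfolding reachable_def len_def by (rule LeastI_ex)

lemma len_le: "w \<in> walks_to e n \<Longrightarrow> len e \<le> n"
  unfolding len_def by (rule Least_le) auto

lemma reachableI: "w \<in> walks_to e n \<Longrightarrow> reachable e"
  unfolding reachable_def by auto

lemma disjoint_walks_to: "e \<noteq> f \<Longrightarrow> walks_to e m \<inter> walks_to f n = {}"
  by (auto simp: walks_to_def)

lemma walks_to_edge: "w \<in> walks_to e n \<Longrightarrow> e \<in> edges G"
  by (auto simp: walks_to_def)

lemma reachable_edge: "reachable e \<Longrightarrow> e \<in> edges G"
  by (auto simp: reachable_def dest: walks_to_edge)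

lemma len_pos: "reachable e \<Longrightarrow> 0 < len e"
  using walks_to_len by (fastforce simp: walks_to_def)

lemma num_pos_iff: "0 < num e \<longleftrightarrow> reachable e"
  using walks_to_len[of e] finite_walks_to[of e "len e"]
  by (auto simp: num_def card_gt_0_iff reachable_def)

text \<open>Infinite \<open>max_wait\<close> makes the upper bound on departures vacuous, leaving
  only \<open>follows\<close> between consecutive edges.\<close>

lemma walk_iff: "walk G s t w \<longleftrightarrow> (\<exists>e. w \<in> walks_to e (length w) \<and> head e = t)"
  unfolding walk_def walks_to_def successively_conv_nth follows_def unrestricted
  by (auto simp: successively_conv_nth)

text \<open>The two parts meet only at \<open>e\<close>, and walks may revisit vertices, so every
  walk ending in \<open>e\<close> can carry every extension of \<open>e\<close>.\<close>

lemma walks_to_append: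
  assumes "w \<in> walks_to e m" "x \<in> extensions e t n"
  shows "w @ x \<in> walks_to (last (e # x)) (m + n)"
  using assms unfolding walks_to_def extensions_def
  by (cases x) (auto simp: successively_append_iff successively_Cons)

lemma walks_to_split:
  assumes "a @ e # x \<in> walks_to f n"
  shows "a @ [e] \<in> walks_to e (Suc (length a))" "x \<in> extensions e (head f) (length x)"
    "n = Suc (length a) + length x"
  using assms unfolding walks_to_def extensions_def
  by (auto simp: successively_append_iff successively_Cons hd_append split: if_splits)

lemma walks_to_Suc_0: "e \<in> edges G \<Longrightarrow> tail e = s \<Longrightarrow> walks_to e (Suc 0) = {[e]}"
  by (auto simp: walks_to_def length_Suc_conv)

lemma source_edge:
  assumes "e \<in> edges G" "tail e = s"
  shows "reachable e" "len e = 1" "num e = 1"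
proof -
  have w: "[e] \<in> walks_to e (Suc 0)" using walks_to_Suc_0[OF assms] by simp
  show r: "reachable e" using reachableI[OF w] .
  show l: "len e = 1" using len_le[OF w] len_pos[OF r] by simp
  show "num e = 1" using walks_to_Suc_0[OF assms] by (simp add: num_def l)
qed

lemma follows_step:
  assumes "reachable f" "follows f e" "e \<in> edges G"
  shows "reachable e" "len e \<le> Suc (len f)"
proof -
  obtain w where w: "w \<in> walks_to f (len f)" using walks_to_len[OF assms(1)] by auto
  have "[e] \<in> extensions f (head e) 1" using assms by (simp add: extensions_def)
  from walks_to_append[OF w this] have "w @ [e] \<in> walks_to e (Suc (len f))" by simp
  then show "reachable e" "len e \<le> Suc (len f)" using reachableI len_le by auto
qed

lemma walks_to_Suc:
  assumes "e \<in> edges G" "tail e \<noteq> s"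
  shows "walks_to e (Suc n) = (\<lambda>w. w @ [e]) ` (\<Union>f \<in> {f \<in> edges G. follows f e}. walks_to f n)"
    (is "_ = ?R")
proof
  show "?R \<subseteq> walks_to e (Suc n)"
    using assms by (auto simp: walks_to_def successively_append_iff)
  show "walks_to e (Suc n) \<subseteq> ?R"
  proof
    fix w assume w: "w \<in> walks_to e (Suc n)"
    define u where "u = butlast w"
    have wu: "w = u @ [e]" using w by (auto simp: walks_to_def u_def)
    \<comment> \<open>Here \<open>tail e \<noteq> s\<close> excludes the one-edge walk
      \<open>[e]\<close>.\<close>
    have "u \<noteq> []" using w assms(2) unfolding wu by (auto simp: walks_to_def)
    then have "u \<in> walks_to (last u) n" "last u \<in> edges G" "follows (last u) e"
      using w last_in_set[of u] unfolding wu
      by (auto simp: walks_to_def successively_append_iff)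
    then show "w \<in> ?R" unfolding wu by blast
  qed
qed

definition optimal_preds :: "'v tedge \<Rightarrow> 'v tedge set" where
  "optimal_preds e = {f \<in> edges G. reachable f \<and> follows f e \<and> len e = Suc (len f)}"

text \<open>Dropping the last edge of a shortest walk ending in \<open>e\<close> leaves a walk
  ending in some \<open>f\<close>; \<open>len f\<close> cannot be below \<open>len e - 1\<close>,
  because \<open>e\<close> extends the shortest walks ending in \<open>f\<close>.\<close>

lemma reachable_pred:
  assumes "reachable e" "tail e \<noteq> s"
  shows "optimal_preds e \<noteq> {}"
proof -
  have e: "e \<in> edges G" using reachable_edge[OF assms(1)] .
  obtain w where w: "w \<in> walks_to e (len e)" using walks_to_len[OF assms(1)] by auto
  obtain n where n: "len e = Suc n" using len_pos[OF assms(1)] by (cases "len e") auto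
  from w n walks_to_Suc[OF e assms(2), of n] obtain f u
    where f: "f \<in> edges G" "follows f e" "u \<in> walks_to f n" by auto
  have "len f \<le> n" "reachable f" using len_le reachableI f by auto
  moreover from this have "len e \<le> Suc (len f)" using follows_step f e by blast
  ultimately have "f \<in> optimal_preds e" using f n by (auto simp: optimal_preds_def)
  then show ?thesis by blast
qed

lemma num_rec:
  assumes "reachable e" "tail e \<noteq> s"
  shows "num e = (\<Sum>f \<in> optimal_preds e. num f)"
proof -
  have e: "e \<in> edges G" using reachable_edge[OF assms(1)] .
  obtain n where n: "len e = Suc n" using len_pos[OF assms(1)] by (cases "len e") auto
  \<comment> \<open>Only optimal predecessors contribute walks of length \<open>n\<close>: such a
    walk gives \<open>len f \<le> n\<close>, and \<open>follows_step\<close> gives the reverse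
    inequality.\<close>
  have "(\<Union>f \<in> {f \<in> edges G. follows f e}. walks_to f n) = (\<Union>f \<in> optimal_preds e. walks_to f n)"
  proof -
    have "f \<in> optimal_preds e" if "follows f e" "u \<in> walks_to f n" for f u
      using that follows_step[of f e] e n len_le[of u f n] reachableI[of u f n]
        walks_to_edge[of u f n] by (auto simp: optimal_preds_def)
    then show ?thesis unfolding optimal_preds_def by blast
  qed
  then have "num e = card (\<Union>f \<in> optimal_preds e. walks_to f n)"
    unfolding num_def n walks_to_Suc[OF e assms(2)] by (subst card_image) (auto simp: inj_on_def)
  also have "\<dots> = (\<Sum>f \<in> optimal_preds e. card (walks_to f n))"
    by (rule card_UN_disjoint)
      (auto simp: optimal_preds_def finite_edges finite_walks_to dest: disjoint_walks_to)
  also have "\<dots> = (\<Sum>f \<in> optimal_preds e. num f)"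
    by (rule sum.cong) (auto simp: optimal_preds_def n num_def)
  finally show ?thesis .
qed

section \<open>Distances and shortest-walk counts at vertices\<close>

lemma distance_le: "e \<in> arrivals t \<Longrightarrow> distance t \<le> len e"
  unfolding distance_def by (simp add: finite_arrivals)

lemma distance_attained: "arrivals t \<noteq> {} \<Longrightarrow> \<exists>e \<in> arrivals t. len e = distance t"
  unfolding distance_def using Min_in[of "len ` arrivals t"] finite_arrivals by fastforce

lemma distance_le_length:
  assumes "w \<in> walks_to e n"
  shows "distance (head e) \<le> n"
proof -
  have "e \<in> arrivals (head e)"
    using assms reachableI walks_to_edge by (auto simp: arrivals_def)
  from distance_le[OF this] len_le[OF assms] show ?thesis by simp
qed

lemma arrivals_iff_walk: "arrivals t \<noteq> {} \<longleftrightarrow> (\<exists>w. walk G s t w)"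
proof
  assume "arrivals t \<noteq> {}"
  then obtain e n w where "head e = t" "w \<in> walks_to e n"
    by (auto simp: arrivals_def reachable_def)
  moreover from this have "length w = n" by (simp add: walks_to_def)
  ultimately show "\<exists>w. walk G s t w" by (auto simp: walk_iff)
next
  assume "\<exists>w. walk G s t w"
  then show "arrivals t \<noteq> {}"
    by (auto simp: walk_iff arrivals_def dest: reachableI walks_to_edge)
qed

lemma shortest_walk_iff:
  "shortest_walk G s t w \<longleftrightarrow> (\<exists>e. w \<in> walks_to e (distance t) \<and> head e = t)"
proof
  assume sw: "shortest_walk G s t w"
  then obtain e where e: "w \<in> walks_to e (length w)" "head e = t"
    by (auto simp: shortest_walk_def walk_iff)
  have "arrivals t \<noteq> {}" using sw arrivals_iff_walk by (auto simp: shortest_walk_def)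
  then obtain f where f: "f \<in> arrivals t" "len f = distance t" using distance_attained by blast
  then obtain u where u: "u \<in> walks_to f (distance t)"
    using walks_to_len[of f] by (auto simp: arrivals_def)
  then have "length u = distance t" by (simp add: walks_to_def)
  moreover from this have "walk G s t u" using u f by (auto simp: walk_iff arrivals_def)
  ultimately have "length w \<le> distance t" using sw by (auto simp: shortest_walk_def)
  moreover have "distance t \<le> length w" using distance_le_length[OF e(1)] e(2) by simp
  ultimately show "\<exists>e. w \<in> walks_to e (distance t) \<and> head e = t" using e by auto
next
  assume "\<exists>e. w \<in> walks_to e (distance t) \<and> head e = t"
  then obtain e where e: "w \<in> walks_to e (distance t)" "head e = t" by blast
  then have l: "length w = distance t" by (simp add: walks_to_def)
  then show "shortest_walk G s t w"
    using e by (auto simp: shortest_walk_def walk_iff dest: distance_le_length)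
qed

lemma sigma_eq: "sigma G s t = (\<Sum>e \<in> {e \<in> arrivals t. len e = distance t}. num e)"
proof -
  have "{w. shortest_walk G s t w} = (\<Union>e \<in> {e \<in> arrivals t. len e = distance t}. walks_to e (distance t))"
  proof -
    \<comment> \<open>A walk of length \<open>distance t\<close> ending in \<open>e\<close> bounds
      \<open>len e\<close> from above by \<open>distance t\<close>, which is also its lower
      bound.\<close>
    have "e \<in> arrivals t \<and> len e = distance t" if "w \<in> walks_to e (distance t)" "head e = t" for w e
    proof -
      have "e \<in> arrivals t"
        using that reachableI walks_to_edge by (auto simp: arrivals_def)
      with distance_le[OF this] len_le[OF that(1)] show ?thesis by simp
    qed
    then show ?thesis unfolding shortest_walk_iff by (auto simp: arrivals_def)
  qed
  then have "sigma G s t = card (\<Union>e \<in> {e \<in> arrivals t. len e = distance t}. walks_to e (distance t))"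
    by (simp add: sigma_def)
  also have "\<dots> = (\<Sum>e \<in> {e \<in> arrivals t. len e = distance t}. card (walks_to e (distance t)))"
    by (rule card_UN_disjoint) (auto simp: finite_arrivals finite_walks_to dest: disjoint_walks_to)
  also have "\<dots> = (\<Sum>e \<in> {e \<in> arrivals t. len e = distance t}. num e)"
    by (rule sum.cong) (auto simp: num_def)
  finally show ?thesis .
qed

text \<open>A shortest walk through \<open>e\<close> is cut after \<open>e\<close> into a walk
  ending in \<open>e\<close> and an extension. The two parts can be chosen independently, hence the
  product.\<close>

lemma sigma_edge_eq: "sigma_edge G s e t = num e * ext_num e t"
proof -
  let ?W = "{w. shortest_walk G s t w \<and> e \<in> set w}"
  let ?X = "extensions e t (distance t - len e)"
  have split: "\<exists>u x. w = u @ x \<and> u \<in> walks_to e (len e) \<and> x \<in> ?X \<and> len e \<le> distance t"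
    if "w \<in> ?W" for w
  proof -
    from that obtain f where f: "w \<in> walks_to f (distance t)" "head f = t"
      by (auto simp: shortest_walk_iff)
    from that obtain a x where w: "w = a @ e # x" by (auto dest: split_list)
    note sp = walks_to_split[OF f(1)[unfolded w]]
    \<comment> \<open>Exchange argument: replacing the prefix by a shortest walk \<open>u\<close>
      ending in \<open>e\<close> still leads to \<open>t\<close>, so the prefix must already have
      length \<open>len e\<close>.\<close>
    from reachableI[OF sp(1)] walks_to_len obtain u where u: "u \<in> walks_to e (len e)" by blast
    have "distance (head (last (e # x))) \<le> len e + length x"
      using distance_le_length[OF walks_to_append[OF u sp(2)]] .
    moreover have "head (last (e # x)) = t" using sp(2) f(2) by (simp add: extensions_def)
    ultimately have "len e = Suc (length a)" "len e \<le> distance t" "distance t - len e = length x"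
      using len_le[OF sp(1)] sp(3) by auto
    then show ?thesis using sp f(2) w by (intro exI[of _ "a @ [e]"] exI[of _ x]) auto
  qed
  show ?thesis
  proof (cases "len e \<le> distance t")
    case True
    have "bij_betw (\<lambda>(u, x). u @ x) (walks_to e (len e) \<times> ?X) ?W"
    proof (rule bij_betw_imageI)
      \<comment> \<open>All first components have length \<open>len e\<close>, so the place of the
        cut is determined.\<close>
      show "inj_on (\<lambda>(u, x). u @ x) (walks_to e (len e) \<times> ?X)"
        by (auto simp: inj_on_def walks_to_def)
      show "(\<lambda>(u, x). u @ x) ` (walks_to e (len e) \<times> ?X) = ?W"
      proof (intro equalityI subsetI)
        fix w assume "w \<in> (\<lambda>(u, x). u @ x) ` (walks_to e (len e) \<times> ?X)"
        then obtain u x where w: "w = u @ x" and u: "u \<in> walks_to e (len e)" and x: "x \<in> ?X"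
          by auto
        have "w \<in> walks_to (last (e # x)) (distance t)"
          using walks_to_append[OF u x] True w by simp
        moreover have "head (last (e # x)) = t" using x by (simp add: extensions_def)
        moreover have "e \<in> set w" using u last_in_set[of u] by (auto simp: w walks_to_def)
        ultimately show "w \<in> ?W" unfolding shortest_walk_iff by blast
      qed (use split in blast)
    qed
    then have "card ?W = card (walks_to e (len e) \<times> ?X)"
      by (rule bij_betw_same_card[symmetric])
    then show ?thesis
      using True by (simp add: sigma_edge_def num_def ext_num_def card_cartesian_product)
  next
    case False
    then have "?W = {}" using split by blast
    then have "sigma_edge G s e t = 0" by (simp only: sigma_edge_def card.empty)
    then show ?thesis using False by (simp add: ext_num_def)
  qed
qed

lemma betweenness_eq: "betweenness G s e = of_nat (num e) * dependency e"
  by (simp add: betweenness_def dependency_def sigma_edge_eq sum_distrib_left)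

section \<open>Recursion for extensions and dependencies\<close>

definition optimal_succs :: "'v tedge \<Rightarrow> 'v tedge set" where
  "optimal_succs e = {f \<in> edges G. reachable f \<and> follows e f \<and> len f = Suc (len e)}"

lemma extensions_0: "extensions e t 0 = (if head e = t then {[]} else {})"
  by (auto simp: extensions_def)

lemma extensions_Suc:
  "extensions e t (Suc n) = (\<Union>f \<in> {f \<in> edges G. follows e f}. (#) f ` extensions f t n)"
  by (auto simp: extensions_def length_Suc_conv image_iff)

text \<open>Extensions are classified by their first edge; the separate term accounts for the empty
  one.\<close>

lemma ext_num_rec:
  assumes "reachable e"
  shows "ext_num e t = (if head e = t \<and> len e = distance t then 1 else 0) +
    (\<Sum>f \<in> optimal_succs e. ext_num f t)"
proof -
  \<comment> \<open>Optimal successors have \<open>len f = Suc (len e)\<close>, so in the first two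
    cases their sum vanishes.\<close>
  consider "distance t < len e" | "len e = distance t" | n where "distance t = Suc (len e + n)"
    by (metis linorder_neqE_nat less_iff_Suc_add)
  then show ?thesis
  proof cases
    case 1
    then show ?thesis by (auto simp: ext_num_def optimal_succs_def intro!: sum.neutral)
  next
    case 2
    then show ?thesis
      by (auto simp: ext_num_def optimal_succs_def extensions_0 intro!: sum.neutral)
  next
    case 3
    \<comment> \<open>A shortest walk ending in \<open>f\<close>, continued by \<open>x\<close>, has
      at least \<open>distance t\<close> edges; this forces
      \<open>len f = Suc (len e)\<close>.\<close>
    have opt: "f \<in> optimal_succs e" if "f \<in> edges G" "follows e f" "x \<in> extensions f t n" for f x
    proof -
      have r: "reachable f" and l: "len f \<le> Suc (len e)"
        using follows_step[OF assms that(2,1)] by auto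
      obtain u where "u \<in> walks_to f (len f)" using walks_to_len[OF r] by blast
      from distance_le_length[OF walks_to_append[OF this that(3)]] that(3)
      have "distance t \<le> len f + n" by (simp add: extensions_def)
      then show ?thesis using that r l 3 by (simp add: optimal_succs_def)
    qed
    have "extensions e t (Suc n) = (\<Union>f \<in> optimal_succs e. (#) f ` extensions f t n)"
      unfolding extensions_Suc using opt unfolding optimal_succs_def by blast
    then have "ext_num e t = card (\<Union>f \<in> optimal_succs e. (#) f ` extensions f t n)"
      by (simp add: ext_num_def 3)
    also have "\<dots> = (\<Sum>f \<in> optimal_succs e. card ((#) f ` extensions f t n))"
      by (rule card_UN_disjoint) (auto simp: optimal_succs_def finite_edges finite_extensions)
    also have "\<dots> = (\<Sum>f \<in> optimal_succs e. ext_num f t)"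
      by (rule sum.cong) (auto simp: optimal_succs_def ext_num_def 3 card_image)
    finally show ?thesis using 3 by simp
  qed
qed

text \<open>Follows from \<open>ext_num_rec\<close> by summing over all targets and exchanging the
  two sums: a Brandes-style accumulation over edges instead of vertices.\<close>

lemma dependency_rec:
  assumes "reachable e"
  shows "dependency e =
    (if head e \<noteq> s \<and> len e = distance (head e) then 1 / of_nat (sigma G s (head e)) else 0) +
    (\<Sum>f \<in> optimal_succs e. dependency f)"
proof -
  let ?T = "{t \<in> verts G. chi G s t = 1}"
  have fin: "finite ?T" by (simp add: finite_verts)
  \<comment> \<open>\<open>chi\<close> excludes \<open>s\<close> as a target, which is where the
    condition \<open>head e \<noteq> s\<close> comes from.\<close>
  have "head e \<in> ?T \<longleftrightarrow> head e \<noteq> s"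
  proof -
    have "arrivals (head e) \<noteq> {}" using assms reachable_edge by (auto simp: arrivals_def)
    then have "\<exists>w. walk G s (head e) w" by (simp add: arrivals_iff_walk)
    moreover have "head e \<in> verts G"
      using wf reachable_edge[OF assms] by (simp add: wf_temporal_graph_def)
    ultimately show ?thesis by (auto simp: chi_def)
  qed
  note T = this
  have "dependency e = (\<Sum>t \<in> ?T.
      (if t = head e then (if len e = distance t then 1 / of_nat (sigma G s t) else 0) else 0) +
      (\<Sum>f \<in> optimal_succs e. of_nat (ext_num f t) / of_nat (sigma G s t)))"
    unfolding dependency_def
    by (rule sum.cong) (auto simp: ext_num_rec[OF assms] add_divide_distrib sum_divide_distrib)
  also have "\<dots> = (\<Sum>t \<in> ?T. if t = head e then
        (if len e = distance t then 1 / of_nat (sigma G s t) else 0) else 0) +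
      (\<Sum>t \<in> ?T. \<Sum>f \<in> optimal_succs e. of_nat (ext_num f t) / of_nat (sigma G s t))"
    by (rule sum.distrib)
  also have "(\<Sum>t \<in> ?T. if t = head e then
        (if len e = distance t then 1 / of_nat (sigma G s t) else 0) else 0) =
      (if head e \<noteq> s \<and> len e = distance (head e) then 1 / of_nat (sigma G s (head e)) else 0)"
    unfolding sum.delta[OF fin] T by simp
  also have "(\<Sum>t \<in> ?T. \<Sum>f \<in> optimal_succs e. of_nat (ext_num f t) / of_nat (sigma G s t)) =
      (\<Sum>f \<in> optimal_succs e. dependency f)"
    unfolding dependency_def by (rule sum.swap)
  finally show ?thesis .
qed

section \<open>Aggregates kept at a vertex during the sweeps\<close>

definition is_best :: "'v tedge set \<Rightarrow> nat \<Rightarrow> rat \<Rightarrow> bool" where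
  "is_best A b c \<longleftrightarrow> (\<forall>f \<in> A. b \<le> len f) \<and> (A \<noteq> {} \<longrightarrow> (\<exists>f \<in> A. len f = b)) \<and>
     c = of_nat (\<Sum>f \<in> {f \<in> A. len f = b}. num f)"

text \<open>\<open>b\<close> stays arbitrary because \<open>best\<close> is never initialised away
  from the source.\<close>

lemma is_best_empty: "is_best {} b 0"
  by (simp add: is_best_def)

text \<open>Reachable edges have positive \<open>num\<close>, so the count itself can serve as the
  flag for emptiness.\<close>

lemma is_best_pos_iff:
  assumes "is_best A b c" "A \<subseteq> Collect reachable"
  shows "0 < c \<longleftrightarrow> A \<noteq> {}"
proof
  assume "A \<noteq> {}"
  then obtain f where f: "f \<in> A" "len f = b" using assms by (auto simp: is_best_def)
  have "A \<subseteq> edges G" using assms reachable_edge by auto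
  then have "finite A" using finite_edges finite_subset by blast
  then have "num f \<le> (\<Sum>f \<in> {f \<in> A. len f = b}. num f)"
    using f by (intro member_le_sum) auto
  moreover have "0 < num f" using f assms num_pos_iff by auto
  ultimately show "0 < c" using assms(1) by (auto simp: is_best_def simp del: of_nat_sum)
qed (use assms in \<open>auto simp: is_best_def\<close>)

text \<open>The conditionals are those of the arrival branch of \<open>forward_body\<close>.\<close>

lemma is_best_insert:
  assumes "is_best A b c" "A \<subseteq> Collect reachable" "e \<notin> A"
  shows "is_best (insert e A)
    (if 0 < c \<and> b \<le> len e then b else len e)
    (if 0 < c \<and> b \<le> len e then if len e = b then c + of_nat (num e) else c else of_nat (num e))"
proof -
  have "finite A" using assms reachable_edge finite_edges finite_subset[of A "edges G"] by auto
  then have fin: "finite {f \<in> A. len f = n}" for n by simp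
  show ?thesis
  proof (cases "0 < c")
    case True
    then have A: "A \<noteq> {}" using is_best_pos_iff[OF assms(1,2)] by simp
    consider "b < len e" | "len e = b" | "len e < b" by linarith
    then show ?thesis
    proof cases
      case 1
      then have "{f \<in> insert e A. len f = b} = {f \<in> A. len f = b}" by auto
      then show ?thesis using 1 True A assms(1) by (simp add: is_best_def)
    next
      case 2
      then have "{f \<in> insert e A. len f = b} = insert e {f \<in> A. len f = b}" by auto
      then show ?thesis using 2 True A assms(1,3) fin by (simp add: is_best_def)
    next
      case 3
      then have "{f \<in> insert e A. len f = len e} = {e}"
        using assms(1) by (auto simp: is_best_def)
      then show ?thesis using 3 True A assms(1,3) by (auto simp: is_best_def)
    qed
  next
    case False
    then have "A = {}" using is_best_pos_iff[OF assms(1,2)] by simp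
    moreover have "{f. f = e \<and> len f = len e} = {e}" by auto
    ultimately show ?thesis using False by (simp add: is_best_def)
  qed
qed

text \<open>For reachable \<open>e\<close>, the least \<open>len\<close> among all predecessors is
  that of the optimal ones, by \<open>reachable_pred\<close> and \<open>follows_step\<close>. An
  unreachable edge has no reachable predecessor, so the marker 0 is passed on.\<close>

lemma is_best_departure:
  assumes b: "is_best {f \<in> edges G. reachable f \<and> follows f e} b c"
    and e: "e \<in> edges G" "tail e \<noteq> s"
  shows "c = of_nat (num e)" "reachable e \<Longrightarrow> len e = Suc b"
proof -
  let ?A = "{f \<in> edges G. reachable f \<and> follows f e}"
  have len: "len e = Suc b" if "reachable e"
  proof -
    from reachable_pred[OF that e(2)] obtain f where f: "f \<in> ?A" "len e = Suc (len f)"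
      by (auto simp: optimal_preds_def)
    then obtain g where g: "g \<in> ?A" "len g = b" using b unfolding is_best_def by blast
    have "len e \<le> Suc (len g)" using follows_step e g by blast
    moreover have "b \<le> len f" using b f unfolding is_best_def by blast
    ultimately show ?thesis using f g by simp
  qed
  then show "reachable e \<Longrightarrow> len e = Suc b" .
  show "c = of_nat (num e)"
  proof (cases "reachable e")
    case True
    have "{f \<in> ?A. len f = b} = optimal_preds e"
      using len[OF True] by (auto simp: optimal_preds_def)
    then show ?thesis using b num_rec[OF True e(2)] by (simp add: is_best_def)
  next
    case False
    then have "?A = {}" using follows_step e by blast
    with b have "is_best {} b c" by metis
    then have "c = 0" by (simp add: is_best_def)
    then show ?thesis using False num_pos_iff[of e] by simp
  qed
qed

lemma is_best_arrivals:
  assumes "is_best (arrivals v) b c" "arrivals v \<noteq> {}"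
  shows "b = distance v" "c = of_nat (sigma G s v)"
proof -
  obtain f where f: "f \<in> arrivals v" "len f = b" using assms by (auto simp: is_best_def)
  obtain g where g: "g \<in> arrivals v" "len g = distance v" using distance_attained assms(2) by blast
  have "distance v \<le> len f" using distance_le f by blast
  moreover have "b \<le> len g" using assms(1) g by (auto simp: is_best_def)
  ultimately show b: "b = distance v" using f g by simp
  show "c = of_nat (sigma G s v)" using assms(1) by (simp add: is_best_def sigma_eq b)
qed

text \<open>Emptiness is encoded by \<open>b = 0\<close>, which is below the \<open>len\<close> of
  every reachable edge; \<open>a\<close> could not signal it, since a reachable edge may have
  dependency 0.\<close>

definition is_top :: "'v tedge set \<Rightarrow> nat \<Rightarrow> rat \<Rightarrow> bool" where
  "is_top F b a \<longleftrightarrow> (\<forall>f \<in> F. len f \<le> b) \<and> (if F = {} then b = 0 else \<exists>f \<in> F. len f = b) \<and>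
     a = (\<Sum>f \<in> {f \<in> F. len f = b}. dependency f)"

lemma is_top_empty: "is_top {} 0 0"
  by (simp add: is_top_def)

lemma is_top_insert:
  assumes "is_top F b a" "finite F" "reachable e" "e \<notin> F"
  shows "is_top (insert e F) (if b < len e then len e else b)
    (if b < len e then dependency e else if len e = b then a + dependency e else a)"
proof -
  have fin: "finite {f \<in> F. len f = n}" for n using assms(2) by simp
  consider "b < len e" | "len e = b" | "len e < b" by linarith
  then show ?thesis
  proof cases
    case 1
    then have "{f \<in> insert e F. len f = len e} = {e}" using assms(1) by (auto simp: is_top_def)
    then show ?thesis using 1 assms(1) by (auto simp: is_top_def)
  next
    case 2
    then have "{f \<in> insert e F. len f = b} = insert e {f \<in> F. len f = b}" by auto
    then show ?thesis using 2 assms(1,4) fin by (simp add: is_top_def)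
  next
    case 3
    then have "{f \<in> insert e F. len f = b} = {f \<in> F. len f = b}" by auto
    moreover have "F \<noteq> {}" using 3 assms(1) by (auto simp: is_top_def)
    ultimately show ?thesis using 3 assms(1) by (simp add: is_top_def)
  qed
qed

text \<open>No edge that can follow \<open>e\<close> has \<open>len\<close> above
  \<open>Suc (len e)\<close>. Hence optimal successors exist iff the greatest \<open>len\<close>
  equals \<open>Suc (len e)\<close>, and they are then the edges attaining it.\<close>

lemma is_top_arrival:
  assumes "is_top {f \<in> edges G. reachable f \<and> follows e f} b a" "reachable e"
  shows "(\<Sum>f \<in> optimal_succs e. dependency f) = (if b = Suc (len e) then a else 0)"
proof (cases "b = Suc (len e)")
  case True
  then have "optimal_succs e = {f \<in> {f \<in> edges G. reachable f \<and> follows e f}. len f = b}"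
    by (auto simp: optimal_succs_def)
  then show ?thesis using assms(1) True by (simp add: is_top_def)
next
  case False
  have "optimal_succs e = {}"
  proof (rule ccontr)
    assume "optimal_succs e \<noteq> {}"
    then obtain f where f: "f \<in> {f \<in> edges G. reachable f \<and> follows e f}" "len f = Suc (len e)"
      by (auto simp: optimal_succs_def)
    then obtain g where g: "g \<in> {f \<in> edges G. reachable f \<and> follows e f}" "len g = b"
      using assms(1) unfolding is_top_def by (metis (no_types, lifting) empty_iff)
    have "Suc (len e) \<le> b" using assms(1) f unfolding is_top_def by metis
    moreover have "b \<le> Suc (len e)" using follows_step[OF assms(2)] g by blast
    ultimately show False using False by simp
  qed
  then show ?thesis using False by simp
qed

end

section \<open>Linear-time loops\<close>

fun loop_free :: "com \<Rightarrow> bool" where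
  "loop_free (Seq c d) \<longleftrightarrow> loop_free c \<and> loop_free d"
| "loop_free (If b c d) \<longleftrightarrow> loop_free c \<and> loop_free d"
| "loop_free (While b c) \<longleftrightarrow> False"
| "loop_free _ \<longleftrightarrow> True"

text \<open>Functional semantics for loop-free code, so that loop bodies can be evaluated by
  rewriting; on a loop the last clause gives a dummy value.\<close>

fun run :: "com \<Rightarrow> state \<Rightarrow> state" where
  "run (NSet x a b) S = nwrite x (nval a S) (nval b S) S"
| "run (QSet x a q) S = qwrite x (nval a S) (qval q S) S"
| "run (Seq c d) S = run d (run c S)"
| "run (If b c d) S = (if bval b S then run c S else run d S)"
| "run _ S = S"

text \<open>Charging both branches of a conditional keeps the bound independent of the
  state.\<close>

fun cost_bound :: "com \<Rightarrow> nat" where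
  "cost_bound (NSet x a b) = 1 + ncost a + ncost b"
| "cost_bound (QSet x a q) = 1 + ncost a + qcost q"
| "cost_bound (Seq c d) = cost_bound c + cost_bound d"
| "cost_bound (If b c d) = 1 + bcost b + cost_bound c + cost_bound d"
| "cost_bound _ = 1"

lemma exec_run: "loop_free c \<Longrightarrow> \<exists>k. exec c S k (run c S) \<and> k \<le> cost_bound c"
proof (induction c arbitrary: S)
  case (Seq c d)
  then obtain k l where "exec c S k (run c S)" "k \<le> cost_bound c"
    "exec d (run c S) l (run d (run c S))" "l \<le> cost_bound d" by fastforce
  then show ?case by (auto intro!: exI[of _ "k + l"] exec.Seq)
next
  case (If b c d)
  then obtain k l where "exec c S k (run c S)" "k \<le> cost_bound c"
    "exec d S l (run d S)" "l \<le> cost_bound d" by fastforce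
  then show ?case
    by (cases "bval b S") (fastforce intro: exec.IfTrue exec.IfFalse)+
qed (fastforce intro: exec.intros)+

definition reaches :: "com \<Rightarrow> state \<Rightarrow> nat \<Rightarrow> (state \<Rightarrow> bool) \<Rightarrow> bool" where
  "reaches c S t Q \<longleftrightarrow> (\<exists>k S'. exec c S k S' \<and> k \<le> t \<and> Q S')"

lemma reaches_loop_free: "loop_free c \<Longrightarrow> Q (run c S) \<Longrightarrow> reaches c S (cost_bound c) Q"
  unfolding reaches_def using exec_run by blast

lemma reaches_Seq:
  assumes "reaches c S t Q" "\<And>S'. Q S' \<Longrightarrow> reaches d S' u R"
  shows "reaches (Seq c d) S (t + u) R"
  using assms unfolding reaches_def by (meson add_mono exec.Seq)

text \<open>The last summand pays for the final, failing test.\<close>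

definition loop_time :: "nat \<Rightarrow> bexp \<Rightarrow> com \<Rightarrow> nat" where
  "loop_time n b c = n * (1 + bcost b + cost_bound c) + (1 + bcost b)"

text \<open>The invariant is indexed by the number of completed iterations, so termination,
  correctness and time follow from one induction on the iterations that remain.\<close>

lemma reaches_While:
  assumes c: "loop_free c" and "I 0 S"
    and step: "\<And>m S. m < n \<Longrightarrow> I m S \<Longrightarrow> bval b S \<and> I (Suc m) (run c S)"
    and exit: "\<And>S. I n S \<Longrightarrow> \<not> bval b S"
  shows "reaches (While b c) S (loop_time n b c) (I n)"
proof -
  have "reaches (While b c) S (d * (1 + bcost b + cost_bound c) + (1 + bcost b)) (I n)"
    if "I m S" "m + d = n" for m d S
    using that
  proof (induction d arbitrary: m S)
    case 0
    then have "\<not> bval b S" "I n S" using exit by auto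
    then show ?case unfolding reaches_def using exec.WhileFalse by fastforce
  next
    case (Suc d)
    then have b: "bval b S" and "I (Suc m) (run c S)" using step[of m S] by auto
    then obtain l S' where l: "exec (While b c) (run c S) l S'" "I n S'"
      "l \<le> d * (1 + bcost b + cost_bound c) + (1 + bcost b)"
      using Suc unfolding reaches_def by fastforce
    obtain k where k: "exec c S k (run c S)" "k \<le> cost_bound c" using exec_run[OF c] by blast
    show ?case unfolding reaches_def
      using exec.WhileTrue[OF b k(1) l(1)] l(2,3) k(2) by force
  qed
  then show ?thesis using assms(2) by (simp add: loop_time_def)
qed

lemma mem_write [simp]:
  "nmem (nwrite x i n S) = (nmem S)(x := (nmem S x)(i := n))"
  "qmem (nwrite x i n S) = qmem S"
  "qmem (qwrite x i r S) = (qmem S)(x := (qmem S x)(i := r))"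
  "nmem (qwrite x i r S) = nmem S"
  by (simp_all add: nwrite_def qwrite_def)

lemma encodes_input_nwrite [simp]:
  assumes "x \<notin> {''source'', ''M'', ''tail'', ''head'', ''dep'', ''trav'', ''Earr'', ''Edep''}"
  shows "encodes_input (nwrite x i n S) es Earr Edep s = encodes_input S es Earr Edep s"
proof -
  have "nmem (nwrite x i n S) y = nmem S y"
    if "y \<in> {''source'', ''M'', ''tail'', ''head'', ''dep'', ''trav'', ''Earr'', ''Edep''}" for y
    using assms that by (metis fun_upd_other mem_write(1))
  note this[of "''source''"] this[of "''M''"] this[of "''tail''"] this[of "''head''"]
    this[of "''dep''"] this[of "''trav''"] this[of "''Earr''"] this[of "''Edep''"]
  then show ?thesis unfolding encodes_input_def by (simp only: insert_iff simp_thms)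
qed

lemma encodes_input_qwrite [simp]:
  "encodes_input (qwrite x i r S) es Earr Edep s = encodes_input S es Earr Edep s"
  by (simp add: encodes_input_def)

section \<open>The program\<close>

abbreviation seq :: "com \<Rightarrow> com \<Rightarrow> com" (infixr ";;" 55) where
  "c ;; d \<equiv> Seq c d"

abbreviation var :: "vname \<Rightarrow> nexp" where
  "var x \<equiv> NGet x (NConst 0)"

abbreviation incr :: "vname \<Rightarrow> com" where
  "incr x \<equiv> NSet x (NConst 0) (NAdd (var x) (NConst 1))"

text \<open>A zero in \<open>num\<close> or \<open>cnt\<close> marks an edge or vertex that has not been reached; the corresponding
  entries of \<open>len\<close>, \<open>best\<close> and \<open>delta\<close> are then meaningless. The source has \<open>best = 0\<close>, which no
  edge attains, so walks returning to it are never counted.\<close>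

definition init_body :: com where
  "init_body =
     QSet ''cnt'' (NGet ''tail'' (var ''j'')) (QConst 0) ;;
     NSet ''top'' (NGet ''tail'' (var ''j'')) (NConst 0) ;;
     QSet ''acc'' (NGet ''tail'' (var ''j'')) (QConst 0) ;;
     QSet ''cnt'' (NGet ''head'' (var ''j'')) (QConst 0) ;;
     NSet ''top'' (NGet ''head'' (var ''j'')) (NConst 0) ;;
     QSet ''acc'' (NGet ''head'' (var ''j'')) (QConst 0) ;;
     incr ''j''"

text \<open>\<open>kind\<close> 0 marks a departure and 1 an arrival. A departure is emitted only if
  no arrival is left or it is strictly earlier than the next one, so ties go to the arrival.\<close>

definition merge_body :: com where
  "merge_body =
     If (BAnd (NLess (var ''p'') (var ''M''))
          (BNot (BAnd (NLess (var ''q'') (var ''M''))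
            (BNot (NLess (NGet ''dep'' (NGet ''Edep'' (var ''p'')))
              (NAdd (NGet ''dep'' (NGet ''Earr'' (var ''q''))) (NGet ''trav'' (NGet ''Earr'' (var ''q'')))))))))
       (NSet ''kind'' (var ''j'') (NConst 0) ;;
        NSet ''ev'' (var ''j'') (NGet ''Edep'' (var ''p'')) ;;
        incr ''p'')
       (NSet ''kind'' (var ''j'') (NConst 1) ;;
        NSet ''ev'' (var ''j'') (NGet ''Earr'' (var ''q'')) ;;
        incr ''q'') ;;
     incr ''j''"

definition forward_body :: com where
  "forward_body =
     NSet ''i'' (NConst 0) (NGet ''ev'' (var ''j'')) ;;
     If (NEq (NGet ''kind'' (var ''j'')) (NConst 0))
       (NSet ''len'' (var ''i'') (NAdd (NGet ''best'' (NGet ''tail'' (var ''i''))) (NConst 1)) ;;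
        QSet ''num'' (var ''i'') (QGet ''cnt'' (NGet ''tail'' (var ''i''))))
       (NSet ''v'' (NConst 0) (NGet ''head'' (var ''i'')) ;;
        If (QLess (QConst 0) (QGet ''num'' (var ''i'')))
          (If (BAnd (QLess (QConst 0) (QGet ''cnt'' (var ''v'')))
                (BNot (NLess (NGet ''len'' (var ''i'')) (NGet ''best'' (var ''v'')))))
            (If (NEq (NGet ''len'' (var ''i'')) (NGet ''best'' (var ''v'')))
              (QSet ''cnt'' (var ''v'') (QAdd (QGet ''cnt'' (var ''v'')) (QGet ''num'' (var ''i''))))
              Skip)
            (NSet ''best'' (var ''v'') (NGet ''len'' (var ''i'')) ;;
             QSet ''cnt'' (var ''v'') (QGet ''num'' (var ''i''))))
          Skip) ;;
     incr ''j''"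

text \<open>At the arrival of an edge, all departures that can follow it have been swept, so its
  dependency can be completed. For an unreached edge \<open>delta\<close> may come from stale cells,
  but multiplying by \<open>num = 0\<close> removes it.\<close>

definition backward_body :: com where
  "backward_body =
     NSet ''j'' (NConst 0) (NSub (var ''j'') (NConst 1)) ;;
     NSet ''i'' (NConst 0) (NGet ''ev'' (var ''j'')) ;;
     If (NEq (NGet ''kind'' (var ''j'')) (NConst 0))
       (NSet ''v'' (NConst 0) (NGet ''tail'' (var ''i'')) ;;
        If (QLess (QConst 0) (QGet ''num'' (var ''i'')))
          (If (NLess (NGet ''top'' (var ''v'')) (NGet ''len'' (var ''i'')))
            (NSet ''top'' (var ''v'') (NGet ''len'' (var ''i'')) ;;
             QSet ''acc'' (var ''v'') (QGet ''delta'' (var ''i'')))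
            (If (NEq (NGet ''len'' (var ''i'')) (NGet ''top'' (var ''v'')))
              (QSet ''acc'' (var ''v'') (QAdd (QGet ''acc'' (var ''v'')) (QGet ''delta'' (var ''i''))))
              Skip))
          Skip)
       (NSet ''v'' (NConst 0) (NGet ''head'' (var ''i'')) ;;
        If (NEq (NGet ''len'' (var ''i'')) (NGet ''best'' (var ''v'')))
          (QSet ''delta'' (var ''i'') (QDiv (QConst 1) (QGet ''cnt'' (var ''v''))))
          (QSet ''delta'' (var ''i'') (QConst 0)) ;;
        If (NEq (NGet ''top'' (var ''v'')) (NAdd (NGet ''len'' (var ''i'')) (NConst 1)))
          (QSet ''delta'' (var ''i'') (QAdd (QGet ''delta'' (var ''i'')) (QGet ''acc'' (var ''v''))))
          Skip ;;
        QSet ''betweenness'' (var ''i'') (QMul (QGet ''num'' (var ''i'')) (QGet ''delta'' (var ''i''))))"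

definition init_test :: bexp where
  "init_test = NLess (var ''j'') (var ''M'')"

definition event_test :: bexp where
  "event_test = NLess (var ''j'') (NAdd (var ''M'') (var ''M''))"

definition backward_test :: bexp where
  "backward_test = NLess (NConst 0) (var ''j'')"

definition reset :: com where
  "reset = NSet ''j'' (NConst 0) (NConst 0)"

text \<open>The source is set after the clearing loop, which zeroes \<open>cnt\<close> at every
  endpoint. The count 1 stands for the empty walk.\<close>

definition start_merge :: com where
  "start_merge =
     NSet ''best'' (var ''source'') (NConst 0) ;;
     QSet ''cnt'' (var ''source'') (QConst 1) ;;
     NSet ''p'' (NConst 0) (NConst 0) ;;
     NSet ''q'' (NConst 0) (NConst 0) ;;
     NSet ''j'' (NConst 0) (NConst 0)"

definition program :: com where
  "program =
     reset ;; While init_test init_body ;;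
     start_merge ;; While event_test merge_body ;;
     reset ;; While event_test forward_body ;;
     While backward_test backward_body"

text \<open>Arrivals are even and departures odd, so that at equal times an arrival precedes a
  departure.\<close>

fun event_key :: "bool \<times> 'v tedge \<Rightarrow> nat" where
  "event_key (is_arr, e) = (if is_arr then 2 * arr e else 2 * dep e + 1)"

locale betweenness_input = unrestricted_temporal_graph G s
  for G :: "nat temporal_graph" and s :: nat +
  fixes Earr Edep es :: "nat tedge list"
  assumes sorted_lists: "doubly_sorted G Earr Edep"
    and distinct_es: "distinct es" and set_es: "set es = edges G"
begin

abbreviation M :: nat where "M \<equiv> length es"

abbreviation input :: "state \<Rightarrow> bool" where
  "input S \<equiv> encodes_input S es Earr Edep s"

text \<open>Apart from the source, only endpoints of edges are initialised, so the time does not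
  depend on the number of vertices.\<close>

definition touched :: "nat set" where
  "touched = tail ` edges G \<union> head ` edges G"

lemma length_sorted_lists: "length Earr = M" "length Edep = M"
  using sorted_lists distinct_es set_es distinct_card[of Earr] distinct_card[of Edep]
    distinct_card[of es] by (auto simp: doubly_sorted_def)

lemma M_eq: "M = card (edges G)"
  using distinct_card[OF distinct_es] set_es by simp

lemma inputD:
  assumes "input S"
  shows "nmem S ''source'' 0 = s" "nmem S ''M'' 0 = M"
    "i < M \<Longrightarrow> nmem S ''tail'' i = tail (es ! i)" "i < M \<Longrightarrow> nmem S ''head'' i = head (es ! i)"
    "i < M \<Longrightarrow> nmem S ''dep'' i = dep (es ! i)" "i < M \<Longrightarrow> nmem S ''trav'' i = trav (es ! i)"
    "i < M \<Longrightarrow> nmem S ''Earr'' i < M" "i < M \<Longrightarrow> es ! nmem S ''Earr'' i = Earr ! i"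
    "i < M \<Longrightarrow> nmem S ''Edep'' i < M" "i < M \<Longrightarrow> es ! nmem S ''Edep'' i = Edep ! i"
  using assms unfolding encodes_input_def length_sorted_lists by blast+

lemma es_edge: "i < M \<Longrightarrow> es ! i \<in> edges G"
  using set_es nth_mem by blast

lemma es_eq_iff: "i < M \<Longrightarrow> k < M \<Longrightarrow> es ! i = es ! k \<longleftrightarrow> i = k"
  using distinct_es nth_eq_iff_index_eq by blast

lemma touched: "e \<in> edges G \<Longrightarrow> tail e \<in> touched" "e \<in> edges G \<Longrightarrow> head e \<in> touched"
  by (auto simp: touched_def)

section \<open>Initialisation\<close>

definition init_inv :: "nat \<Rightarrow> state \<Rightarrow> bool" where
  "init_inv n S \<longleftrightarrow> input S \<and> nmem S ''j'' 0 = n \<and>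
     (\<forall>k < n. \<forall>v \<in> {tail (es ! k), head (es ! k)}.
        qmem S ''cnt'' v = 0 \<and> nmem S ''top'' v = 0 \<and> qmem S ''acc'' v = 0)"

definition clean :: "state \<Rightarrow> bool" where
  "clean S \<longleftrightarrow> (\<forall>v \<in> touched. nmem S ''top'' v = 0 \<and> qmem S ''acc'' v = 0 \<and>
     (if v = s then nmem S ''best'' v = 0 \<and> qmem S ''cnt'' v = 1 else qmem S ''cnt'' v = 0))"

lemma init_step:
  assumes "n < M" "init_inv n S"
  shows "bval init_test S \<and> init_inv (Suc n) (run init_body S)"
proof -
  have S: "input S" "nmem S ''j'' 0 = n" using assms by (auto simp: init_inv_def)
  note i = inputD[OF S(1)]
  show ?thesis
    using assms S i(2) i(3,4)[OF assms(1)]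
    by (simp add: init_test_def init_body_def init_inv_def less_Suc_eq)
qed

lemma start_merge_clean:
  assumes "init_inv M S"
  shows "input (run start_merge S)" "clean (run start_merge S)"
    "nmem (run start_merge S) ''p'' 0 = 0" "nmem (run start_merge S) ''q'' 0 = 0"
    "nmem (run start_merge S) ''j'' 0 = 0"
proof -
  have S: "input S" using assms by (auto simp: init_inv_def)
  note i = inputD[OF S(1)]
  have z: "qmem S ''cnt'' v = 0 \<and> nmem S ''top'' v = 0 \<and> qmem S ''acc'' v = 0"
    if "v \<in> touched" for v
    using that assms unfolding touched_def set_es[symmetric] init_inv_def
    by (auto simp: in_set_conv_nth)
  show "input (run start_merge S)" "clean (run start_merge S)"
    "nmem (run start_merge S) ''p'' 0 = 0" "nmem (run start_merge S) ''q'' 0 = 0"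
    "nmem (run start_merge S) ''j'' 0 = 0"
    using S i(1) z by (simp_all add: start_merge_def clean_def)
qed

section \<open>Merging\<close>

definition merging :: "(bool \<times> nat tedge) list \<Rightarrow> nat \<Rightarrow> nat \<Rightarrow> bool" where
  "merging xs p q \<longleftrightarrow> p \<le> M \<and> q \<le> M \<and> length xs = p + q \<and>
     set xs = Pair False ` set (take p Edep) \<union> Pair True ` set (take q Earr) \<and>
     sorted (map event_key xs) \<and>
     (\<forall>x \<in> set xs. \<forall>y \<in> Pair False ` set (drop p Edep) \<union> Pair True ` set (drop q Earr).
        event_key x \<le> event_key y)"

lemma sorted_nth_drop:
  assumes "sorted (map f xs)" "p < length xs" "y \<in> set (drop p xs)"
  shows "f (xs ! p) \<le> f y"
proof -
  obtain k where "k < length xs - p" "y = xs ! (p + k)"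
    using assms(2,3) by (auto simp: in_set_conv_nth)
  then show ?thesis using assms(1,2) by (auto simp: sorted_iff_nth_mono)
qed

lemma merging_departure:
  assumes "merging xs p q" "p < M" "q < M \<longrightarrow> dep (Edep ! p) < arr (Earr ! q)"
  shows "merging (xs @ [(False, Edep ! p)]) (Suc p) q"
proof -
  have p: "p < length Edep" using assms(2) length_sorted_lists by simp
  have t: "set (take (Suc p) Edep) = insert (Edep ! p) (set (take p Edep))"
    using p by (simp add: take_Suc_conv_app_nth)
  have d: "set (drop p Edep) = insert (Edep ! p) (set (drop (Suc p) Edep))"
    using p by (simp add: Cons_nth_drop_Suc[symmetric])
  \<comment> \<open>Strictness of \<open>dep < arr\<close> puts the odd key of the departure below
    the even keys of the pending arrivals.\<close>
  have a: "Suc (2 * dep (Edep ! p)) \<le> 2 * arr y" if "y \<in> set (drop q Earr)" for y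
  proof -
    have q: "q < length Earr" using that by (cases "q < length Earr") auto
    then have "arr (Earr ! q) \<le> arr y"
      using sorted_nth_drop[of arr Earr q y] sorted_lists that by (simp add: doubly_sorted_def)
    then show ?thesis using assms(3) q length_sorted_lists by simp
  qed
  have b: "dep (Edep ! p) \<le> dep y" if "y \<in> set (drop p Edep)" for y
    using sorted_nth_drop[of dep Edep p y] sorted_lists that p by (simp add: doubly_sorted_def)
  let ?x = "(False, Edep ! p)" and ?R = "Pair False ` set (drop (Suc p) Edep) \<union> Pair True ` set (drop q Earr)"
  have "\<forall>y \<in> set xs. event_key y \<le> event_key ?x"
    using assms(1) unfolding merging_def d by blast
  moreover have "\<forall>y \<in> ?R. event_key ?x \<le> event_key y"
    using a b d by auto
  moreover have "\<forall>y \<in> set xs. \<forall>z \<in> ?R. event_key y \<le> event_key z"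
    using assms(1) unfolding merging_def d by blast
  moreover have "sorted (map event_key xs)" "length xs = p + q" "p \<le> M" "q \<le> M"
    using assms(1) unfolding merging_def by blast+
  moreover have "set xs = Pair False ` set (take p Edep) \<union> Pair True ` set (take q Earr)"
    using assms(1) unfolding merging_def by blast
  ultimately show ?thesis
    unfolding merging_def t using assms(2) by (simp add: sorted_append ball_Un del: event_key.simps)
qed

lemma merging_arrival:
  assumes "merging xs p q" "q < M" "p < M \<longrightarrow> arr (Earr ! q) \<le> dep (Edep ! p)"
  shows "merging (xs @ [(True, Earr ! q)]) p (Suc q)"
proof -
  have q: "q < length Earr" using assms(2) length_sorted_lists by simp
  have t: "set (take (Suc q) Earr) = insert (Earr ! q) (set (take q Earr))"
    using q by (simp add: take_Suc_conv_app_nth)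
  have d: "set (drop q Earr) = insert (Earr ! q) (set (drop (Suc q) Earr))"
    using q by (simp add: Cons_nth_drop_Suc[symmetric])
  have a: "2 * arr (Earr ! q) \<le> Suc (2 * dep y)" if "y \<in> set (drop p Edep)" for y
  proof -
    have p: "p < length Edep" using that by (cases "p < length Edep") auto
    then have "dep (Edep ! p) \<le> dep y"
      using sorted_nth_drop[of dep Edep p y] sorted_lists that by (simp add: doubly_sorted_def)
    then show ?thesis using assms(3) p length_sorted_lists by simp
  qed
  have b: "arr (Earr ! q) \<le> arr y" if "y \<in> set (drop q Earr)" for y
    using sorted_nth_drop[of arr Earr q y] sorted_lists that q by (simp add: doubly_sorted_def)
  let ?x = "(True, Earr ! q)" and ?R = "Pair False ` set (drop p Edep) \<union> Pair True ` set (drop (Suc q) Earr)"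
  have "\<forall>y \<in> set xs. event_key y \<le> event_key ?x"
    using assms(1) unfolding merging_def d by blast
  moreover have "\<forall>y \<in> ?R. event_key ?x \<le> event_key y"
    using a b d by auto
  moreover have "\<forall>y \<in> set xs. \<forall>z \<in> ?R. event_key y \<le> event_key z"
    using assms(1) unfolding merging_def d by blast
  moreover have "sorted (map event_key xs)" "length xs = p + q" "p \<le> M" "q \<le> M"
    using assms(1) unfolding merging_def by blast+
  moreover have "set xs = Pair False ` set (take p Edep) \<union> Pair True ` set (take q Earr)"
    using assms(1) unfolding merging_def by blast
  ultimately show ?thesis
    unfolding merging_def t using assms(2) by (simp add: sorted_append ball_Un del: event_key.simps)
qed

definition event :: "state \<Rightarrow> nat \<Rightarrow> bool \<times> nat tedge" where
  "event S k = (nmem S ''kind'' k \<noteq> 0, es ! nmem S ''ev'' k)"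

definition merge_inv :: "nat \<Rightarrow> state \<Rightarrow> bool" where
  "merge_inv n S \<longleftrightarrow> input S \<and> clean S \<and> nmem S ''j'' 0 = n \<and> (\<forall>k < n. nmem S ''ev'' k < M) \<and>
     merging (map (event S) [0..<n]) (nmem S ''p'' 0) (nmem S ''q'' 0)"

lemma merge_step:
  assumes "n < 2 * M" "merge_inv n S"
  shows "bval event_test S \<and> merge_inv (Suc n) (run merge_body S)"
proof -
  let ?p = "nmem S ''p'' 0" and ?q = "nmem S ''q'' 0"
  have S: "input S" "clean S" "nmem S ''j'' 0 = n" "\<forall>k < n. nmem S ''ev'' k < M"
    and m: "merging (map (event S) [0..<n]) ?p ?q"
    using assms(2) by (auto simp: merge_inv_def)
  note i = inputD[OF S(1)]
  have pq: "?p \<le> M" "?q \<le> M" "?p + ?q = n" using m by (auto simp: merging_def)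
  have t: "bval event_test S" using assms(1) S i(2) by (simp add: event_test_def)
  show ?thesis
  proof (cases "?p < M \<and> (?q < M \<longrightarrow> dep (Edep ! ?p) < arr (Earr ! ?q))")
    case True
    let ?S = "nwrite ''j'' 0 (Suc n) (nwrite ''p'' 0 (Suc ?p)
      (nwrite ''ev'' n (nmem S ''Edep'' ?p) (nwrite ''kind'' n 0 S)))"
    have r: "run merge_body S = ?S"
      using True S i by (auto simp: merge_body_def arr_def)
    have "map (event ?S) [0..<Suc n] = map (event S) [0..<n] @ [(False, Edep ! ?p)]"
      using i True by (auto simp: event_def)
    then have "merging (map (event ?S) [0..<Suc n]) (Suc ?p) ?q"
      using merging_departure[OF m True[THEN conjunct1] True[THEN conjunct2]] by (simp only:)
    then show ?thesis
      using S t i True unfolding r by (auto simp: merge_inv_def clean_def)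
  next
    case False
    \<comment> \<open>If no arrival were left, \<open>n < 2 * M\<close> would leave a departure and
      the first case would apply.\<close>
    then have q: "?q < M" "?p < M \<longrightarrow> arr (Earr ! ?q) \<le> dep (Edep ! ?p)"
      using pq assms(1) by auto
    let ?S = "nwrite ''j'' 0 (Suc n) (nwrite ''q'' 0 (Suc ?q)
      (nwrite ''ev'' n (nmem S ''Earr'' ?q) (nwrite ''kind'' n 1 S)))"
    have r: "run merge_body S = ?S"
      using False q S i by (auto simp: merge_body_def arr_def)
    have "map (event ?S) [0..<Suc n] = map (event S) [0..<n] @ [(True, Earr ! ?q)]"
      using i q by (auto simp: event_def)
    then have "merging (map (event ?S) [0..<Suc n]) ?p (Suc ?q)"
      using merging_arrival[OF m q] by (simp only:)
    then show ?thesis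
      using S t i q unfolding r by (auto simp: merge_inv_def clean_def)
  qed
qed

section \<open>Chronological schedules\<close>

definition schedule :: "(bool \<times> nat tedge) list \<Rightarrow> bool" where
  "schedule xs \<longleftrightarrow> length xs = 2 * M \<and> distinct xs \<and> set xs = UNIV \<times> edges G \<and>
     sorted (map event_key xs)"

lemma merging_schedule:
  assumes "merging xs p q" "length xs = 2 * M"
  shows "schedule xs"
proof -
  have "p = M" "q = M" using assms by (auto simp: merging_def)
  then have s: "set xs = UNIV \<times> edges G"
    using assms(1) sorted_lists length_sorted_lists
    by (auto simp: merging_def doubly_sorted_def UNIV_bool)
  \<comment> \<open>Distinctness by counting: \<open>2 * M\<close> entries cover a set of
    \<open>2 * M\<close> events.\<close>
  then have "card (set xs) = length xs"
    using assms(2) M_eq by (simp add: card_cartesian_product)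
  then show ?thesis using s assms by (auto simp: schedule_def merging_def card_distinct)
qed

text \<open>By parity, equal keys occur only between two arrivals or two departures, so these facts
  settle the order of any arrival relative to any departure.\<close>

lemma schedule_take:
  assumes "schedule xs" "n < 2 * M"
  shows "xs ! n \<notin> set (take n xs)" "y \<in> set (take n xs) \<Longrightarrow> event_key y \<le> event_key (xs ! n)"
    "y \<in> set xs \<Longrightarrow> event_key y < event_key (xs ! n) \<Longrightarrow> y \<in> set (take n xs)"
proof -
  have n: "n < length xs" using assms by (simp add: schedule_def)
  have srt: "event_key (xs ! i) \<le> event_key (xs ! k)" if "i \<le> k" "k < length xs" for i k
    using assms(1) that by (auto simp: schedule_def sorted_iff_nth_mono)
  show "xs ! n \<notin> set (take n xs)"
    using assms n by (auto simp: schedule_def in_set_conv_nth nth_eq_iff_index_eq)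
  show "y \<in> set (take n xs) \<Longrightarrow> event_key y \<le> event_key (xs ! n)"
    using srt n by (auto simp: in_set_conv_nth)
  show "y \<in> set (take n xs)" if y: "y \<in> set xs" "event_key y < event_key (xs ! n)"
  proof -
    obtain k where "k < length xs" "y = xs ! k" using y(1) by (auto simp: in_set_conv_nth)
    moreover from this have "k < n" using srt[of n k] y(2) by (cases "k < n") auto
    ultimately show ?thesis using n by (auto simp: in_set_conv_nth)
  qed
qed

lemma schedule_drop:
  assumes "schedule xs" "n < 2 * M"
  shows "y \<in> set (drop (Suc n) xs) \<longleftrightarrow> y \<in> set xs \<and> y \<noteq> xs ! n \<and> y \<notin> set (take n xs)"
proof -
  have n: "n < length xs" using assms by (simp add: schedule_def)
  have "set xs = set (take n xs) \<union> insert (xs ! n) (set (drop (Suc n) xs))"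
    using arg_cong[OF id_take_nth_drop[OF n], of set] by simp
  moreover have "distinct (take n xs @ xs ! n # drop (Suc n) xs)"
    using assms(1) id_take_nth_drop[OF n] by (simp add: schedule_def)
  ultimately show ?thesis by auto
qed

definition scheduled :: "(bool \<times> nat tedge) list \<Rightarrow> state \<Rightarrow> bool" where
  "scheduled xs S \<longleftrightarrow> input S \<and> (\<forall>k < 2 * M. nmem S ''ev'' k < M \<and> event S k = xs ! k)"

lemma merge_inv_schedule:
  assumes "merge_inv (2 * M) S"
  shows "\<exists>xs. schedule xs \<and> scheduled xs S \<and> clean S"
  using assms merging_schedule
  by (intro exI[of _ "map (event S) [0..<2 * M]"]) (auto simp: merge_inv_def scheduled_def)

section \<open>Forward sweep\<close>

definition arrived :: "(bool \<times> nat tedge) set \<Rightarrow> nat \<Rightarrow> nat tedge set" where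
  "arrived X v = {f \<in> edges G. reachable f \<and> (True, f) \<in> X \<and> head f = v}"

definition counts :: "(bool \<times> nat tedge) set \<Rightarrow> state \<Rightarrow> bool" where
  "counts X S \<longleftrightarrow> (\<forall>v \<in> touched. if v = s then nmem S ''best'' v = 0 \<and> qmem S ''cnt'' v = 1
     else is_best (arrived X v) (nmem S ''best'' v) (qmem S ''cnt'' v))"

text \<open>The labels of an edge are written at its departure, hence the guard
  \<open>(False, es ! i) \<in> X\<close>.\<close>

definition labels :: "(bool \<times> nat tedge) set \<Rightarrow> state \<Rightarrow> bool" where
  "labels X S \<longleftrightarrow> (\<forall>i < M. (False, es ! i) \<in> X \<longrightarrow>
     qmem S ''num'' i = of_nat (num (es ! i)) \<and>
     (reachable (es ! i) \<longrightarrow> nmem S ''len'' i = len (es ! i)))"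

definition forward_inv :: "(bool \<times> nat tedge) list \<Rightarrow> nat \<Rightarrow> state \<Rightarrow> bool" where
  "forward_inv xs n S \<longleftrightarrow> scheduled xs S \<and> nmem S ''j'' 0 = n \<and>
     (\<forall>v \<in> touched. nmem S ''top'' v = 0 \<and> qmem S ''acc'' v = 0) \<and>
     counts (set (take n xs)) S \<and> labels (set (take n xs)) S"

text \<open>Arrivals precede departures at equal times, so when \<open>e\<close> departs the
  processed arrivals are exactly those with \<open>arr f \<le> dep e\<close>.\<close>

lemma schedule_arrived:
  assumes "schedule xs" "n < 2 * M" "xs ! n = (False, e)"
  shows "arrived (set (take n xs)) (tail e) = {f \<in> edges G. reachable f \<and> follows f e}"
proof -
  have "(True, f) \<in> set (take n xs) \<longleftrightarrow> arr f \<le> dep e" if "f \<in> edges G" for f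
  proof -
    have "(True, f) \<in> set xs" using assms(1) that by (simp add: schedule_def)
    then show ?thesis using schedule_take(2,3)[OF assms(1,2), of "(True, f)"] assms(3) by auto
  qed
  then show ?thesis by (auto simp: arrived_def follows_def)
qed

lemma dep_less_arr: "e \<in> edges G \<Longrightarrow> dep e < arr e"
  using wf by (simp add: wf_temporal_graph_def arr_def)

lemma forward_departure:
  assumes sch: "schedule xs" and n: "n < 2 * M" and inv: "forward_inv xs n S"
    and kind: "nmem S ''kind'' n = 0"
  shows "forward_inv xs (Suc n) (run forward_body S)"
proof -
  define i where "i = nmem S ''ev'' n"
  define e where "e = es ! i"
  let ?X = "set (take n xs)"
  have sS: "scheduled xs S" and S: "input S" "nmem S ''j'' 0 = n" and c: "counts ?X S"
    and l: "labels ?X S"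
    using inv by (auto simp: forward_inv_def scheduled_def)
  note inp = inputD[OF S(1)]
  have i: "i < M" "xs ! n = (False, e)"
    using sS n kind by (auto simp: scheduled_def event_def i_def e_def)
  have e: "e \<in> edges G" using es_edge i e_def by simp
  have X: "set (take (Suc n) xs) = insert (False, e) ?X"
    using sch n i(2) by (simp add: schedule_def take_Suc_conv_app_nth)
  have t: "nmem S ''tail'' i = tail e" using inp i e_def by simp
  let ?S = "nwrite ''j'' 0 (Suc n) (qwrite ''num'' i (qmem S ''cnt'' (tail e))
    (nwrite ''len'' i (Suc (nmem S ''best'' (tail e))) (nwrite ''i'' 0 i S)))"
  have r: "run forward_body S = ?S"
    using S kind t by (simp add: forward_body_def i_def[symmetric])
  \<comment> \<open>At the source, \<open>best = 0\<close> and \<open>cnt = 1\<close> yield the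
    values 1 and 1 of \<open>source_edge\<close>.\<close>
  have lab: "qmem S ''cnt'' (tail e) = of_nat (num e)"
    "reachable e \<longrightarrow> Suc (nmem S ''best'' (tail e)) = len e"
  proof -
    have "qmem S ''cnt'' (tail e) = of_nat (num e) \<and>
      (reachable e \<longrightarrow> Suc (nmem S ''best'' (tail e)) = len e)"
    proof (cases "tail e = s")
      case True
      then show ?thesis using c touched(1)[OF e] source_edge[OF e True] by (auto simp: counts_def)
    next
      case False
      then have "is_best {f \<in> edges G. reachable f \<and> follows f e}
        (nmem S ''best'' (tail e)) (qmem S ''cnt'' (tail e))"
        using c touched(1)[OF e] schedule_arrived[OF sch n i(2)] by (auto simp: counts_def)
      from is_best_departure[OF this e False] show ?thesis by simp
    qed
    then show "qmem S ''cnt'' (tail e) = of_nat (num e)"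
      "reachable e \<longrightarrow> Suc (nmem S ''best'' (tail e)) = len e" by auto
  qed
  have "scheduled xs ?S" using sS by (simp add: scheduled_def event_def)
  moreover have "counts (insert (False, e) ?X) ?S"
  proof -
    have "arrived (insert (False, e) ?X) v = arrived ?X v" for v by (simp add: arrived_def)
    then show ?thesis using c by (simp add: counts_def)
  qed
  moreover have "labels (insert (False, e) ?X) ?S"
    using l lab i es_eq_iff[of _ i] by (auto simp: labels_def e_def)
  ultimately show ?thesis using inv unfolding r forward_inv_def X by simp
qed

lemma forward_arrival:
  assumes sch: "schedule xs" and n: "n < 2 * M" and inv: "forward_inv xs n S"
    and kind: "nmem S ''kind'' n \<noteq> 0"
  shows "forward_inv xs (Suc n) (run forward_body S)"
proof -
  define i where "i = nmem S ''ev'' n"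
  define e where "e = es ! i"
  define v where "v = head e"
  let ?X = "set (take n xs)" and ?S = "run forward_body S"
  let ?b = "nmem S ''best'' v" and ?c = "qmem S ''cnt'' v"
  have sS: "scheduled xs S" and S: "input S" "nmem S ''j'' 0 = n" and c: "counts ?X S"
    and l: "labels ?X S"
    using inv by (auto simp: forward_inv_def scheduled_def)
  note inp = inputD[OF S(1)]
  have i: "i < M" "xs ! n = (True, e)"
    using sS n kind by (auto simp: scheduled_def event_def i_def e_def)
  have e: "e \<in> edges G" using es_edge i e_def by simp
  have X: "set (take (Suc n) xs) = insert (True, e) ?X"
    using sch n i(2) by (simp add: schedule_def take_Suc_conv_app_nth)
  have new: "(True, e) \<notin> ?X" using schedule_take(1)[OF sch n] i(2) by simp
  have "(False, e) \<in> ?X"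
    using schedule_take(3)[OF sch n, of "(False, e)"] sch e i(2) dep_less_arr[OF e]
    by (simp add: schedule_def)
  \<comment> \<open>Travel times are positive, so the departure of \<open>e\<close> came earlier and
    its labels are already stored.\<close>
  then have lab: "qmem S ''num'' i = of_nat (num e)" "reachable e \<Longrightarrow> nmem S ''len'' i = len e"
    using l i(1) by (auto simp: labels_def e_def)
  have t: "nmem S ''head'' i = v" using inp i e_def v_def by simp
  have v: "v \<in> touched" using touched(2)[OF e] v_def by simp
  have np: "0 < num e \<longleftrightarrow> reachable e" by (rule num_pos_iff)
  \<comment> \<open>If \<open>e\<close> is unreachable, \<open>num\<close> is 0 and the outer test
    fails, so the unspecified contents of \<open>len\<close> have no effect.\<close>
  have upd: "nmem ?S ''best'' w = (if w = v \<and> reachable e \<and> \<not> (0 < ?c \<and> ?b \<le> len e)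
        then len e else nmem S ''best'' w)"
      "qmem ?S ''cnt'' w = (if w = v \<and> reachable e then
        if 0 < ?c \<and> ?b \<le> len e then if len e = ?b then ?c + of_nat (num e) else ?c
        else of_nat (num e) else qmem S ''cnt'' w)" for w
    using S kind t lab np
    by (cases "reachable e"; simp add: forward_body_def i_def[symmetric] not_less; fail)+
  have frame: "input ?S" "nmem ?S ''j'' 0 = Suc n" "nmem ?S ''kind'' = nmem S ''kind''"
    "nmem ?S ''ev'' = nmem S ''ev''" "nmem ?S ''top'' = nmem S ''top''"
    "nmem ?S ''len'' = nmem S ''len''" "qmem ?S ''acc'' = qmem S ''acc''"
    "qmem ?S ''num'' = qmem S ''num''"
    using S kind by (simp_all add: forward_body_def)
  have "scheduled xs ?S" using sS frame by (simp add: scheduled_def event_def)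
  moreover have "labels (insert (True, e) ?X) ?S"
    using l frame by (simp add: labels_def)
  moreover have "counts (insert (True, e) ?X) ?S"
    unfolding counts_def
  proof
    fix w assume w: "w \<in> touched"
    show "if w = s then nmem ?S ''best'' w = 0 \<and> qmem ?S ''cnt'' w = 1
      else is_best (arrived (insert (True, e) ?X) w) (nmem ?S ''best'' w) (qmem ?S ''cnt'' w)"
    proof (cases "w = v \<and> reachable e")
      case True
      show ?thesis
      proof (cases "w = s")
        \<comment> \<open>An edge back into the source has \<open>len e > 0\<close>, which exceeds
          \<open>best = 0\<close>, so nothing is updated.\<close>
        case s: True
        then have "?b = 0" "?c = 1" using True c v by (auto simp: counts_def)
        then show ?thesis using s True upd len_pos[of e] by auto
      next
        case False
        have A: "arrived (insert (True, e) ?X) w = insert e (arrived ?X w)"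
          using True e by (auto simp: arrived_def v_def)
        have "is_best (arrived ?X w) ?b ?c" using c v False True by (auto simp: counts_def)
        moreover have "arrived ?X w \<subseteq> Collect reachable" "e \<notin> arrived ?X w"
          using new by (auto simp: arrived_def)
        ultimately have "is_best (insert e (arrived ?X w)) (if 0 < ?c \<and> ?b \<le> len e then ?b else len e)
          (if 0 < ?c \<and> ?b \<le> len e then if len e = ?b then ?c + of_nat (num e) else ?c
           else of_nat (num e))"
          by (rule is_best_insert)
        moreover have "nmem ?S ''best'' w = (if 0 < ?c \<and> ?b \<le> len e then ?b else len e)"
          using upd(1) True by auto
        moreover have "qmem ?S ''cnt'' w = (if 0 < ?c \<and> ?b \<le> len e
          then if len e = ?b then ?c + of_nat (num e) else ?c else of_nat (num e))"
          using upd(2) True by auto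
        ultimately show ?thesis using False by (simp only: A if_False)
      qed
    next
      case False
      then have "arrived (insert (True, e) ?X) w = arrived ?X w"
        by (auto simp: arrived_def v_def)
      moreover have "nmem ?S ''best'' w = nmem S ''best'' w" "qmem ?S ''cnt'' w = qmem S ''cnt'' w"
        using upd False by auto
      ultimately show ?thesis using bspec[OF c[unfolded counts_def] w] by (simp only:)
    qed
  qed
  ultimately show ?thesis using inv frame unfolding forward_inv_def X by simp
qed

lemma forward_step:
  assumes "schedule xs" "n < 2 * M" "forward_inv xs n S"
  shows "bval event_test S \<and> forward_inv xs (Suc n) (run forward_body S)"
proof -
  have "bval event_test S"
    using assms inputD(2)[of S] by (auto simp: event_test_def forward_inv_def scheduled_def)
  then show ?thesis using forward_departure[OF assms] forward_arrival[OF assms] by blast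
qed

section \<open>Backward sweep\<close>

definition departed :: "(bool \<times> nat tedge) set \<Rightarrow> nat \<Rightarrow> nat tedge set" where
  "departed X v = {f \<in> edges G. reachable f \<and> (False, f) \<in> X \<and> tail f = v}"

text \<open>At the source \<open>best = 0\<close> differs from the \<open>len\<close> of every
  reachable edge, so no walk is taken to end there.\<close>

definition counted :: "state \<Rightarrow> bool" where
  "counted S \<longleftrightarrow> (\<forall>v \<in> touched. if v = s then nmem S ''best'' v = 0
     else arrivals v \<noteq> {} \<longrightarrow>
       nmem S ''best'' v = distance v \<and> qmem S ''cnt'' v = of_nat (sigma G s v))"

definition tops :: "(bool \<times> nat tedge) set \<Rightarrow> state \<Rightarrow> bool" where
  "tops X S \<longleftrightarrow> (\<forall>v \<in> touched. is_top (departed X v) (nmem S ''top'' v) (qmem S ''acc'' v))"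

definition solved :: "(bool \<times> nat tedge) set \<Rightarrow> state \<Rightarrow> bool" where
  "solved X S \<longleftrightarrow> (\<forall>i < M. (True, es ! i) \<in> X \<longrightarrow>
     qmem S ''betweenness'' i = betweenness G s (es ! i) \<and>
     (reachable (es ! i) \<longrightarrow> qmem S ''delta'' i = dependency (es ! i)))"

definition backward_inv :: "(bool \<times> nat tedge) list \<Rightarrow> nat \<Rightarrow> state \<Rightarrow> bool" where
  "backward_inv xs n S \<longleftrightarrow> scheduled xs S \<and> nmem S ''j'' 0 = 2 * M - n \<and>
     labels (set xs) S \<and> counted S \<and>
     tops (set (drop (2 * M - n) xs)) S \<and> solved (set (drop (2 * M - n) xs)) S"

lemma backward_start:
  assumes sch: "schedule xs" and inv: "forward_inv xs (2 * M) S"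
  shows "backward_inv xs 0 S"
proof -
  have xs: "take (2 * M) xs = xs" "drop (2 * M) xs = []" "set xs = UNIV \<times> edges G"
    using sch by (auto simp: schedule_def)
  \<comment> \<open>After the full sweep every reachable edge has arrived, so the aggregates are the
    distances and the numbers of shortest walks.\<close>
  have "arrived (set xs) v = arrivals v" for v
    unfolding arrived_def arrivals_def xs(3) by auto
  then have "counted S"
    using inv is_best_arrivals unfolding forward_inv_def counts_def counted_def xs by metis
  moreover have "tops {} S"
    using inv is_top_empty by (auto simp: forward_inv_def tops_def departed_def)
  ultimately show ?thesis
    using inv xs(1,2) by (simp add: backward_inv_def forward_inv_def solved_def)
qed

lemma schedule_departed:
  assumes "schedule xs" "n < 2 * M" "xs ! n = (True, e)"
  shows "departed (set (drop (Suc n) xs)) (head e) = {f \<in> edges G. reachable f \<and> follows e f}"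
proof -
  have "(False, f) \<in> set (drop (Suc n) xs) \<longleftrightarrow> arr e \<le> dep f" if "f \<in> edges G" for f
  proof -
    have "(False, f) \<in> set xs" using assms(1) that by (simp add: schedule_def)
    \<comment> \<open>An odd and an even key never coincide, so strict and weak comparison
      agree.\<close>
    moreover have "event_key (False, f) < event_key (xs ! n) \<longleftrightarrow> dep f < arr e"
      "event_key (False, f) \<le> event_key (xs ! n) \<longleftrightarrow> dep f < arr e"
      unfolding assms(3) event_key.simps by auto
    ultimately have "(False, f) \<in> set (take n xs) \<longleftrightarrow> dep f < arr e"
      using schedule_take(2,3)[OF assms(1,2), of "(False, f)"] by blast
    then show ?thesis
      using \<open>(False, f) \<in> set xs\<close> assms(3) by (auto simp: schedule_drop[OF assms(1,2)])
  qed
  then show ?thesis by (auto simp: departed_def follows_def)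
qed

lemma backward_departure:
  assumes sch: "schedule xs" and n: "n < 2 * M" and inv: "backward_inv xs n S"
    and m: "m = 2 * M - Suc n" and kind: "nmem S ''kind'' m = 0"
  shows "backward_inv xs (Suc n) (run backward_body S)"
proof -
  define i where "i = nmem S ''ev'' m"
  define e where "e = es ! i"
  define v where "v = tail e"
  let ?X = "set (drop (Suc m) xs)" and ?S = "run backward_body S"
  let ?b = "nmem S ''top'' v" and ?a = "qmem S ''acc'' v"
  have mM: "m < 2 * M" "2 * M - n = Suc m" using n m by auto
  have sS: "scheduled xs S" and S: "input S" "nmem S ''j'' 0 = Suc m" and c: "counted S"
    and l: "labels (set xs) S" and tp: "tops ?X S" and so: "solved ?X S"
    using inv mM by (auto simp: backward_inv_def scheduled_def)
  note inp = inputD[OF S(1)]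
  have i: "i < M" "xs ! m = (False, e)"
    using sS mM kind by (auto simp: scheduled_def event_def i_def e_def)
  have e: "e \<in> edges G" using es_edge i e_def by simp
  have X: "set (drop m xs) = insert (False, e) ?X"
    using sch mM i(2) Cons_nth_drop_Suc[of m xs] by (simp add: schedule_def) (metis list.set(2))
  have new: "(False, e) \<notin> ?X" using schedule_drop[OF sch mM(1)] i(2) by simp
  \<comment> \<open>The arrival of \<open>e\<close> lies later in the schedule, so the backward
    sweep has already computed its dependency.\<close>
  have "(True, e) \<in> ?X"
    using schedule_drop[OF sch mM(1), of "(True, e)"] schedule_take(2)[OF sch mM(1), of "(True, e)"]
      sch e i(2) dep_less_arr[OF e] by (auto simp: schedule_def)
  then have del: "reachable e \<Longrightarrow> qmem S ''delta'' i = dependency e"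
    using so i(1) by (auto simp: solved_def e_def)
  have lab: "qmem S ''num'' i = of_nat (num e)" "reachable e \<Longrightarrow> nmem S ''len'' i = len e"
    using l sch e i(1) by (auto simp: labels_def e_def schedule_def)
  have t: "nmem S ''tail'' i = v" using inp i e_def v_def by simp
  have np: "0 < num e \<longleftrightarrow> reachable e" by (rule num_pos_iff)
  have upd: "nmem ?S ''top'' w = (if w = v \<and> reachable e then if ?b < len e then len e else ?b
        else nmem S ''top'' w)"
      "qmem ?S ''acc'' w = (if w = v \<and> reachable e then if ?b < len e then dependency e
        else if len e = ?b then ?a + dependency e else ?a else qmem S ''acc'' w)" for w
    using S kind t lab np del
    by (cases "reachable e"; simp add: backward_body_def i_def[symmetric] not_less; fail)+
  have frame: "input ?S" "nmem ?S ''j'' 0 = m" "nmem ?S ''kind'' = nmem S ''kind''"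
    "nmem ?S ''ev'' = nmem S ''ev''" "nmem ?S ''best'' = nmem S ''best''"
    "nmem ?S ''len'' = nmem S ''len''" "qmem ?S ''cnt'' = qmem S ''cnt''"
    "qmem ?S ''num'' = qmem S ''num''" "qmem ?S ''delta'' = qmem S ''delta''"
    "qmem ?S ''betweenness'' = qmem S ''betweenness''"
    using S kind by (simp_all add: backward_body_def)
  have "scheduled xs ?S" using sS frame by (simp add: scheduled_def event_def)
  moreover have "labels (set xs) ?S" using l frame by (simp add: labels_def)
  moreover have "counted ?S" using c frame by (simp add: counted_def)
  moreover have "solved (insert (False, e) ?X) ?S" using so frame by (simp add: solved_def)
  moreover have "tops (insert (False, e) ?X) ?S"
    unfolding tops_def
  proof
    fix w assume w: "w \<in> touched"
    show "is_top (departed (insert (False, e) ?X) w) (nmem ?S ''top'' w) (qmem ?S ''acc'' w)"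
    proof (cases "w = v \<and> reachable e")
      case True
      have A: "departed (insert (False, e) ?X) w = insert e (departed ?X w)"
        using True e by (auto simp: departed_def v_def)
      have "is_top (departed ?X w) ?b ?a" using tp w True by (auto simp: tops_def)
      moreover have "finite (departed ?X w)" "e \<notin> departed ?X w"
        using new finite_edges by (auto simp: departed_def)
      ultimately have "is_top (insert e (departed ?X w)) (if ?b < len e then len e else ?b)
        (if ?b < len e then dependency e else if len e = ?b then ?a + dependency e else ?a)"
        using True is_top_insert by blast
      then show ?thesis unfolding A upd using True by (simp only: simp_thms if_True)
    next
      case False
      then have "departed (insert (False, e) ?X) w = departed ?X w"
        by (auto simp: departed_def v_def)
      moreover have "nmem ?S ''top'' w = nmem S ''top'' w" "qmem ?S ''acc'' w = qmem S ''acc'' w"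
        using upd False by auto
      ultimately show ?thesis using tp w by (simp add: tops_def)
    qed
  qed
  ultimately show ?thesis using frame(2) unfolding backward_inv_def m[symmetric] X by simp
qed

lemma backward_arrival:
  assumes sch: "schedule xs" and n: "n < 2 * M" and inv: "backward_inv xs n S"
    and m: "m = 2 * M - Suc n" and kind: "nmem S ''kind'' m \<noteq> 0"
  shows "backward_inv xs (Suc n) (run backward_body S)"
proof -
  define i where "i = nmem S ''ev'' m"
  define e where "e = es ! i"
  define v where "v = head e"
  let ?X = "set (drop (Suc m) xs)" and ?S = "run backward_body S"
  \<comment> \<open>Formed from raw memory cells, so that the effect of the body is described for
    unreachable \<open>e\<close> as well.\<close>
  define d where "d = (if nmem S ''len'' i = nmem S ''best'' v then 1 / qmem S ''cnt'' v else 0) +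
    (if nmem S ''top'' v = Suc (nmem S ''len'' i) then qmem S ''acc'' v else 0)"
  have mM: "m < 2 * M" "2 * M - n = Suc m" using n m by auto
  have sS: "scheduled xs S" and S: "input S" "nmem S ''j'' 0 = Suc m" and c: "counted S"
    and l: "labels (set xs) S" and tp: "tops ?X S" and so: "solved ?X S"
    using inv mM by (auto simp: backward_inv_def scheduled_def)
  note inp = inputD[OF S(1)]
  have i: "i < M" "xs ! m = (True, e)"
    using sS mM kind by (auto simp: scheduled_def event_def i_def e_def)
  have e: "e \<in> edges G" using es_edge i e_def by simp
  have v: "v \<in> touched" using touched(2)[OF e] v_def by simp
  have X: "set (drop m xs) = insert (True, e) ?X"
    using sch mM i(2) Cons_nth_drop_Suc[of m xs] by (simp add: schedule_def) (metis list.set(2))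
  have lab: "qmem S ''num'' i = of_nat (num e)" "reachable e \<Longrightarrow> nmem S ''len'' i = len e"
    using l sch e i(1) by (auto simp: labels_def e_def schedule_def)
  have t: "nmem S ''head'' i = v" using inp i e_def v_def by simp
  have dep: "d = dependency e" if r: "reachable e"
  proof -
    have "is_top {f \<in> edges G. reachable f \<and> follows e f} (nmem S ''top'' v) (qmem S ''acc'' v)"
      using tp v schedule_departed[OF sch mM(1) i(2)] by (auto simp: tops_def v_def)
    note succ = is_top_arrival[OF this r]
    have "arrivals v \<noteq> {}" using r e by (auto simp: arrivals_def v_def)
    \<comment> \<open>At the source \<open>best = 0 < len e\<close> gives 0, in agreement with the
      exclusion of \<open>s\<close> as a target.\<close>
    then have "(if len e = nmem S ''best'' v then 1 / qmem S ''cnt'' v else 0) =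
      (if v \<noteq> s \<and> len e = distance v then 1 / of_nat (sigma G s v) else 0)"
      using bspec[OF c[unfolded counted_def] v] len_pos[OF r] by (auto split: if_splits)
    then show ?thesis
      unfolding d_def dependency_rec[OF r] succ lab(2)[OF r] v_def by simp
  qed
  have upd: "qmem ?S ''delta'' = (qmem S ''delta'')(i := d)"
      "qmem ?S ''betweenness'' = (qmem S ''betweenness'')(i := of_nat (num e) * d)"
    using S kind t lab(1) by (simp_all add: backward_body_def i_def[symmetric] d_def)
  have frame: "input ?S" "nmem ?S ''j'' 0 = m" "nmem ?S ''kind'' = nmem S ''kind''"
    "nmem ?S ''ev'' = nmem S ''ev''" "nmem ?S ''best'' = nmem S ''best''"
    "nmem ?S ''len'' = nmem S ''len''" "qmem ?S ''cnt'' = qmem S ''cnt''"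
    "qmem ?S ''num'' = qmem S ''num''" "nmem ?S ''top'' = nmem S ''top''"
    "qmem ?S ''acc'' = qmem S ''acc''"
    using S kind by (simp_all add: backward_body_def)
  \<comment> \<open>For unreachable \<open>e\<close>, \<open>num e = 0\<close> makes both sides 0
    whatever \<open>d\<close> is.\<close>
  have bt: "of_nat (num e) * d = betweenness G s e"
    using dep num_pos_iff[of e] by (cases "reachable e") (auto simp: betweenness_eq)
  have "scheduled xs ?S" using sS frame by (simp add: scheduled_def event_def)
  moreover have "labels (set xs) ?S" using l frame by (simp add: labels_def)
  moreover have "counted ?S" using c frame by (simp add: counted_def)
  moreover have "solved (insert (True, e) ?X) ?S"
    using so upd dep bt i es_eq_iff[of _ i] by (auto simp: solved_def e_def)
  moreover have "tops (insert (True, e) ?X) ?S"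
    using tp frame by (simp add: tops_def departed_def)
  ultimately show ?thesis using frame(2) unfolding backward_inv_def m[symmetric] X by simp
qed

lemma backward_step:
  assumes "schedule xs" "n < 2 * M" "backward_inv xs n S"
  shows "bval backward_test S \<and> backward_inv xs (Suc n) (run backward_body S)"
proof -
  have "bval backward_test S"
    using assms by (simp add: backward_test_def backward_inv_def)
  then show ?thesis using backward_departure[OF assms] backward_arrival[OF assms] by blast
qed

lemma backward_inv_solved:
  assumes "schedule xs" "backward_inv xs (2 * M) S" "i < M"
  shows "qmem S ''betweenness'' i = betweenness G s (es ! i)"
  using assms es_edge by (auto simp: schedule_def backward_inv_def solved_def)

end

section \<open>Linear running time and correctness of the whole program\<close>

definition run_time :: "nat \<Rightarrow> nat" where
  "run_time M = cost_bound reset + (loop_time M init_test init_body +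
     (cost_bound start_merge + (loop_time (2 * M) event_test merge_body +
     (cost_bound reset + (loop_time (2 * M) event_test forward_body +
     loop_time (2 * M) backward_test backward_body)))))"

lemma loop_free_bodies:
  "loop_free reset" "loop_free init_body" "loop_free start_merge" "loop_free merge_body"
  "loop_free forward_body" "loop_free backward_body"
  by (simp_all add: reset_def init_body_def start_merge_def merge_body_def forward_body_def
      backward_body_def)

lemma run_time_linear: "(\<lambda>M. real (run_time M)) \<in> O(\<lambda>M. real M)"
proof -
  have "\<exists>a b. \<forall>M. run_time M = a * M + b"
    unfolding run_time_def loop_time_def
    \<comment> \<open>The slope collects the costs per iteration; the factor 2 reflects that three
      of the loops run through \<open>2 * M\<close> events.\<close>
    by (intro exI[of _ "(1 + bcost init_test + cost_bound init_body) +
          2 * (1 + bcost event_test + cost_bound merge_body) +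
          2 * (1 + bcost event_test + cost_bound forward_body) +
          2 * (1 + bcost backward_test + cost_bound backward_body)"]
        exI[of _ "2 * cost_bound reset + cost_bound start_merge + (1 + bcost init_test) +
          2 * (1 + bcost event_test) + (1 + bcost backward_test)"]) (simp add: algebra_simps)
  then obtain a b where ab: "\<And>M. run_time M = a * M + b" by blast
  have "\<forall>\<^sub>F M in sequentially. norm (real (run_time M)) \<le> real (a + b) * norm (real M)"
    using eventually_ge_at_top[of 1]
  proof eventually_elim
    case (elim M)
    \<comment> \<open>For \<open>M \<ge> 1\<close> the constant term is absorbed into the linear
      one.\<close>
    then have "b \<le> b * M" by simp
    then have "run_time M \<le> (a + b) * M" unfolding ab by (simp add: algebra_simps)
    then have "real (run_time M) \<le> real ((a + b) * M)" by (simp only: of_nat_le_iff)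
    then show ?case by simp
  qed
  then show ?thesis by (rule bigoI)
qed

lemma (in betweenness_input) program_correct:
  assumes "input S"
  shows "reaches program S (run_time M)
    (\<lambda>S'. \<forall>i < M. qmem S' ''betweenness'' i = betweenness G s (es ! i))"
proof -
  let ?done = "\<lambda>S'. \<forall>i < M. qmem S' ''betweenness'' i = betweenness G s (es ! i)"
  let ?ti = "loop_time M init_test init_body" and ?tm = "loop_time (2 * M) event_test merge_body"
    and ?tf = "loop_time (2 * M) event_test forward_body"
    and ?tb = "loop_time (2 * M) backward_test backward_body"
  let ?sweeps = "reset ;; While event_test forward_body ;; While backward_test backward_body"
  \<comment> \<open>The schedule is read off the memory after merging, so it is obtained inside this
    claim and then fixed for both sweeps.\<close>
  have sweeps: "reaches ?sweeps S (cost_bound reset + (?tf + ?tb)) ?done"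
    if merged: "merge_inv (2 * M) S" for S
  proof -
    obtain xs where xs: "schedule xs" "scheduled xs S" "clean S"
      using merge_inv_schedule[OF merged] by blast
    \<comment> \<open>No event has been processed, so every endpoint except the source holds the
      aggregate of the empty set.\<close>
    have "forward_inv xs 0 (run reset S)"
      using xs(2,3) is_best_empty by (auto simp: forward_inv_def reset_def scheduled_def
          event_def clean_def counts_def labels_def arrived_def)
    then have reset: "reaches reset S (cost_bound reset) (forward_inv xs 0)"
      using loop_free_bodies(1) by (rule reaches_loop_free[rotated])
    have forward: "reaches (While event_test forward_body) S ?tf (forward_inv xs (2 * M))"
      if "forward_inv xs 0 S" for S
      using loop_free_bodies(5) that forward_step[OF xs(1)]
      by (rule reaches_While) (auto simp: forward_inv_def scheduled_def event_test_def inputD(2))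
    have backward: "reaches (While backward_test backward_body) S ?tb ?done"
      if "forward_inv xs (2 * M) S" for S
    proof -
      have "reaches (While backward_test backward_body) S ?tb (backward_inv xs (2 * M))"
        using loop_free_bodies(6) backward_start[OF xs(1) that] backward_step[OF xs(1)]
        by (rule reaches_While) (auto simp: backward_inv_def backward_test_def)
      then show ?thesis using backward_inv_solved[OF xs(1)] unfolding reaches_def by blast
    qed
    show ?thesis by (rule reaches_Seq[OF reset reaches_Seq[OF forward backward]])
  qed
  have merge: "reaches (While event_test merge_body) S ?tm (merge_inv (2 * M))"
    if "merge_inv 0 S" for S
    using loop_free_bodies(4) that merge_step
    by (rule reaches_While) (auto simp: merge_inv_def event_test_def inputD(2))
  have start: "reaches start_merge S (cost_bound start_merge) (merge_inv 0)"
    if "init_inv M S" for S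
    using loop_free_bodies(3) start_merge_clean[OF that]
    by (intro reaches_loop_free) (auto simp: merge_inv_def merging_def)
  have init: "reaches (While init_test init_body) S ?ti (init_inv M)" if "init_inv 0 S" for S
    using loop_free_bodies(2) that init_step
    by (rule reaches_While) (auto simp: init_inv_def init_test_def inputD(2))
  have reset: "reaches reset S (cost_bound reset) (init_inv 0)"
    using assms loop_free_bodies(1)
    by (intro reaches_loop_free) (auto simp: init_inv_def reset_def)
  show ?thesis
    unfolding program_def run_time_def
    by (rule reaches_Seq[OF reset reaches_Seq[OF init reaches_Seq[OF start
          reaches_Seq[OF merge sweeps]]]])
qed

theorem theorem2:
  "\<exists>(P :: com) (T :: nat \<Rightarrow> nat).
     (\<lambda>M. real (T M)) \<in> O(\<lambda>M. real M) \<and>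
     (\<forall>(G :: nat temporal_graph) Earr Edep s es S.
        wf_temporal_graph G \<and> max_wait G = \<infinity> \<and> doubly_sorted G Earr Edep \<and> s \<in> verts G \<and>
        encodes_input S es Earr Edep s \<longrightarrow>
        (\<exists>k S'. exec P S k S' \<and> k \<le> T (card (edges G)) \<and>
           (\<forall>i < length es. qmem S' ''betweenness'' i = betweenness G s (es ! i))))"
proof (intro exI[of _ program] exI[of _ run_time] conjI allI impI)
  show "(\<lambda>M. real (run_time M)) \<in> O(\<lambda>M. real M)" by (rule run_time_linear)
  fix G :: "nat temporal_graph" and Earr Edep s es S
  assume a: "wf_temporal_graph G \<and> max_wait G = \<infinity> \<and> doubly_sorted G Earr Edep \<and> s \<in> verts G \<and>
    encodes_input S es Earr Edep s"
  then interpret betweenness_input G s Earr Edep es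
    by unfold_locales (auto simp: encodes_input_def doubly_sorted_def)
  show "\<exists>k S'. exec program S k S' \<and> k \<le> run_time (card (edges G)) \<and>
    (\<forall>i < length es. qmem S' ''betweenness'' i = betweenness G s (es ! i))"
    using program_correct[of S] a unfolding reaches_def M_eq by blast
qed

end
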